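(* Assume (A2) and (A3), and consider parameter values $(\eta,\sigma^2,b,d)$ for which $\rho<0$, so that the tail-index $\alpha$ (the unique $\alpha>0$ with $h(\alpha)=1$) is defined. Then: the tail-index $\alpha$ is strictly increasing in the batch-size $b$ and strictly decreasing in the stepsize $\eta$ and in the variance $\sigma^2$, provided that $\alpha\ge 1$; moreover, $\alpha$ is strictly decreasing in the dimension $d$.
   Context: Setup: integers $d,b\ge1$, stepsize $\eta>0$, i.i.d. data $(a_i,y_i)$ with $a_i\in\mathbb{R}^d$, $y_i\in\mathbb{R}$; $H_k=\sum_{i=b(k-1)+1}^{bk}a_ia_i^T$, $M_k=I_d-\frac{\eta}{b}H_k$, $q_k=\frac{\eta}{b}\sum_{i=b(k-1)+1}^{bk}a_iy_i$, SGD iterates $x_k=M_kx_{k-1}+q_k$. $\|\cdot\|$ is the Euclidean/spectral norm. $\Pi_k=M_k\cdots M_1$, $h(s)=\lim_{k\to\infty}(\mathbb{E}\|\Pi_k\|^s)^{1/k}$, $\rho=\lim_{k\to\infty}(2k)^{-1}\log\lambda_{\max}(\Pi_k^T\Pi_k)$. Assumptions: (A2) $y_i$ i.i.d. with continuous density supported on $\mathbb{R}$, all moments finite. (A3) $a_i\sim\mathcal{N}(0,\sigma^2I_d)$ i.i.d. Under these assumptions and $\rho<0$ there is a unique $\alpha>0$ with $h(\alpha)=1$, called the tail-index. *)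

theory Defs
  imports "HOL-Probability.Probability" "Jordan_Normal_Form.Char_Poly"
begin

text \<open>Parameters: stepsize eta, variance v (= sigma^2), batch size b, dimension d.
  All data are realised on one canonical probability space: a sample
  omega :: nat \<times> nat \<Rightarrow> real, where omega (i, j) is the j-th coordinate
  (j < d) of the data vector a_i (i \<ge> 1). All coordinates are i.i.d.
  N(0, v), i.e. a_i ~ N(0, v I_d) i.i.d.  The responses y_i do not enter
  h, rho or the tail-index, so they are not modelled.\<close>

definition data_space :: "real \<Rightarrow> (nat \<times> nat \<Rightarrow> real) measure" where
  "data_space v = PiM UNIV (\<lambda>_. density lborel (normal_density 0 (sqrt v)))"

definition avec :: "nat \<Rightarrow> (nat \<times> nat \<Rightarrow> real) \<Rightarrow> nat \<Rightarrow> real vec" where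
  "avec d \<omega> i = vec d (\<lambda>j. \<omega> (i, j))"

definition Hmat :: "nat \<Rightarrow> nat \<Rightarrow> (nat \<times> nat \<Rightarrow> real) \<Rightarrow> nat \<Rightarrow> real mat" where
  "Hmat b d \<omega> k = mat d d (\<lambda>(p, q). \<Sum>i\<in>{b * (k - 1) + 1 .. b * k}.
      (avec d \<omega> i) $ p * (avec d \<omega> i) $ q)"

definition Mmat :: "real \<Rightarrow> nat \<Rightarrow> nat \<Rightarrow> (nat \<times> nat \<Rightarrow> real) \<Rightarrow> nat \<Rightarrow> real mat" where
  "Mmat \<eta> b d \<omega> k = 1\<^sub>m d - (\<eta> / real b) \<cdot>\<^sub>m Hmat b d \<omega> k"

fun Pimat :: "real \<Rightarrow> nat \<Rightarrow> nat \<Rightarrow> (nat \<times> nat \<Rightarrow> real) \<Rightarrow> nat \<Rightarrow> real mat" where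
  "Pimat \<eta> b d \<omega> 0 = 1\<^sub>m d"
| "Pimat \<eta> b d \<omega> (Suc k) = Mmat \<eta> b d \<omega> (Suc k) * Pimat \<eta> b d \<omega> k"

definition vnorm :: "real vec \<Rightarrow> real" where
  "vnorm x = sqrt (scalar_prod x x)"

definition spec_norm :: "nat \<Rightarrow> real mat \<Rightarrow> real" where
  "spec_norm d A = Sup {vnorm (A *\<^sub>v x) | x. x \<in> carrier_vec d \<and> vnorm x = 1}"

definition lambda_max :: "real mat \<Rightarrow> real" where
  "lambda_max A = Max {l. eigenvalue A l}"

definition hfun :: "real \<Rightarrow> real \<Rightarrow> nat \<Rightarrow> nat \<Rightarrow> real \<Rightarrow> real" where
  "hfun \<eta> v b d s = lim (\<lambda>k. (\<integral>\<omega>. spec_norm d (Pimat \<eta> b d \<omega> k) powr s \<partial>data_space v)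
      powr (1 / real k))"

definition rho :: "real \<Rightarrow> real \<Rightarrow> nat \<Rightarrow> nat \<Rightarrow> real" where
  "rho \<eta> v b d = (THE r. AE \<omega> in data_space v.
      (\<lambda>k. ln (lambda_max (transpose_mat (Pimat \<eta> b d \<omega> k) * Pimat \<eta> b d \<omega> k))
         / (2 * real k)) \<longlonglongrightarrow> r)"

definition admissible :: "real \<Rightarrow> real \<Rightarrow> nat \<Rightarrow> nat \<Rightarrow> bool" where
  "admissible \<eta> v b d \<longleftrightarrow> \<eta> > 0 \<and> v > 0 \<and> b \<ge> 1 \<and> d \<ge> 1 \<and> rho \<eta> v b d < 0"

definition tail_index :: "real \<Rightarrow> real \<Rightarrow> nat \<Rightarrow> nat \<Rightarrow> real" where
  "tail_index \<eta> v b d = (THE \<alpha>. \<alpha> > 0 \<and> hfun \<eta> v b d \<alpha> = 1)"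

end

theory Submission
  imports Defs
begin

text \<open>By rotation invariance of the Gaussian law and independence of the batches,
  E |Pi_k u|^s = g(s)^k for every unit vector u, where g(s) = E |M_1 e_1|^s. The spectral norm of Pi_k lies
  between |Pi_k e_1| and the sum of the |Pi_k e_j|, hence h = g on the positive reals. The slope of g at 0
  is E ln |M_1 e_1|, and Markov's inequality with small positive and negative s together with the
  Borel-Cantelli lemma identifies it with rho. As g is convex with g(0) = 1, for rho < 0 the tail-index is
  the point where g crosses 1 from below, so it suffices to compare the functions g for different
  parameters. Enlarging d adds a square to |M_1 e_1|^2. For s \<ge> 1, Minkowski's and Jensen's inequalities
  show that g is strictly convex in eta * sigma^2, with value 1 at 0, and, after averaging leave-one-out
  batches, that g strictly decreases in b.\<close>

section \<open>Convex functions and Euclidean norms\<close>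

lemma convex_on_less_closed_segment:
  assumes "convex_on S f" "x \<in> S" "y \<in> S" "f x < c" "f y \<le> c"
    and z_mem: "z \<in> closed_segment x y" "z \<noteq> y"
  shows "f z < c"
proof -
  obtain t where convex_combination: "0 \<le> t" "t \<le> 1" "z = (1 - t) *\<^sub>R x + t *\<^sub>R y"
    using z_mem(1) by (auto simp: closed_segment_def)
  have "t < 1" using convex_combination z_mem(2) by (cases "t = 1") auto
  have "f z \<le> (1 - t) * f x + t * f y"
    unfolding convex_combination(3) using assms convex_combination by (intro convex_onD)
  also have "\<dots> < (1 - t) * c + t * c"
    using assms(4,5) convex_combination(1) \<open>t < 1\<close>
    by (intro add_less_le_mono mult_strict_left_mono mult_left_mono) auto
  finally show ?thesis by (simp add: algebra_simps)
qed

lemma convex_on_level_crossing: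
  fixes f :: "real \<Rightarrow> real"
  assumes convex: "convex_on {a..} f" and cont: "continuous_on {a..} f" and start: "f a = c"
    and below: "a < x" "f x < c" and above: "a < y" "c < f y"
  obtains z where "a < z" "\<And>u. a < u \<Longrightarrow> f u = c \<longleftrightarrow> u = z" "\<And>u. a < u \<Longrightarrow> f u < c \<longleftrightarrow> u < z"
proof -
  note segment_less = convex_on_less_closed_segment[OF convex, where c=c]
  have below_imp_below: "f u < c" if "a < u" "u \<le> x" for u
    using that below start segment_less[of x a u]
    by (cases "u = x") (auto simp: closed_segment_eq_real_ivl)
  then have "x < y" using above by force
  then obtain z where z_crossing: "x \<le> z" "z \<le> y" "f z = c"
    using IVT'[of f x c y] below above continuous_on_subset[OF cont, of "{x..y}"] by auto
  then have "x < z" using below(2) by (cases "x = z") auto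
  have left: "f u < c" if "a < u" "u < z" for u
    using that below z_crossing below_imp_below segment_less[of x z u]
    by (cases "u \<le> x") (auto simp: closed_segment_eq_real_ivl)
  have right: "c < f u" if "z < u" for u
    using that below z_crossing \<open>x < z\<close> segment_less[of x u z]
    by (force simp: closed_segment_eq_real_ivl)
  show ?thesis
  proof (rule that[of z])
    show "a < z" using below \<open>x < z\<close> by simp
    show "f u = c \<longleftrightarrow> u = z" "f u < c \<longleftrightarrow> u < z" if "a < u" for u
      using left[of u] right[of u] that z_crossing(3) by (cases u z rule: linorder_cases; force)+
  qed
qed

lemma convex_on_powr:
  assumes "p \<ge> 1"
  shows "convex_on {0..} (\<lambda>x::real. x powr p)"
proof (rule convex_onI)
  fix t x y :: real
  assume t_bounds: "0 < t" "t < 1" and args_nonneg: "x \<in> {0..}" "y \<in> {0..}"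
  have scale: "(u * x) powr p \<le> u * x powr p" if "0 \<le> x" "0 < u" "u < 1" for u x
    using that assms powr_mono'[of 1 p u] by (simp add: powr_mult mult_right_mono)
  show "((1 - t) *\<^sub>R x + t *\<^sub>R y) powr p \<le> (1 - t) * x powr p + t * y powr p"
  proof (cases "x = 0 \<or> y = 0")
    case True
    then show ?thesis using scale[of y t] scale[of x "1 - t"] t_bounds args_nonneg assms by auto
  next
    case False
    then show ?thesis
      using convex_onD[OF powr_convex[OF assms], of t x y] t_bounds args_nonneg by auto
  qed
qed simp

lemma L2_set_power2: "(L2_set u A)\<^sup>2 = (\<Sum>i\<in>A. (u i)\<^sup>2)"
  by (simp add: L2_set_def sum_nonneg)

lemma L2_set_cmult: "L2_set (\<lambda>i. t * u i) A = \<bar>t\<bar> * L2_set u A"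
  by (simp add: L2_set_def power_mult_distrib sum_distrib_left[symmetric] real_sqrt_mult)

lemma L2_set_indicator_singleton [simp]:
  assumes "finite A" "j \<in> A"
  shows "L2_set (indicator {j}) A = 1"
proof -
  have "(indicat_real {j} i)\<^sup>2 = (if i = j then 1 else 0)" for i
    by simp
  then show ?thesis using assms by (simp add: L2_set_def)
qed

lemma abs_le_L2_set:
  assumes "finite A" "i \<in> A"
  shows "\<bar>u i\<bar> \<le> L2_set u A"
  using member_le_L2_set[OF assms, of "\<lambda>i. \<bar>u i\<bar>"] by (simp add: L2_set_def)

lemma L2_set_mono2:
  assumes "finite B" "A \<subseteq> B"
  shows "L2_set u A \<le> L2_set u B"
  unfolding L2_set_def using assms by (intro real_sqrt_le_mono sum_mono2) auto

lemma L2_set_strict_mono2: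
  assumes "finite B" "A \<subseteq> B" "k \<in> B - A" "u k \<noteq> 0"
  shows "L2_set u A < L2_set u B"
  unfolding L2_set_def using assms by (intro real_sqrt_less_mono sum_strict_mono2[of B A k]) auto

lemma continuous_on_L2_set [continuous_intros]:
  assumes "\<And>i. i \<in> A \<Longrightarrow> continuous_on S (\<lambda>x. f x i)"
  shows "continuous_on S (\<lambda>x. L2_set (f x) A)"
  unfolding L2_set_def by (intro continuous_intros assms)

lemma L2_set_sum_le: "L2_set (\<lambda>i. \<Sum>j\<in>J. u j i) A \<le> (\<Sum>j\<in>J. L2_set (u j) A)"
proof (induction J rule: infinite_finite_induct)
  case (insert j J)
  then show ?case
    using L2_set_triangle_ineq[of "u j" "\<lambda>i. \<Sum>j\<in>J. u j i" A] by simp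
qed (simp_all add: L2_set_def)

lemma L2_set_add_less:
  assumes "finite A" "k \<in> A" and signs: "x k > 0" "y k < 0"
  shows "L2_set (\<lambda>i. x i + y i) A < L2_set x A + L2_set y A"
proof (rule power2_less_imp_less)
  have products_le: "x i * y i \<le> \<bar>x i\<bar> * \<bar>y i\<bar>" for i
    by (simp flip: abs_mult)
  have "x k * y k < \<bar>x k\<bar> * \<bar>y k\<bar>"
    using signs by (simp add: mult_pos_neg)
  with products_le assms(1,2) have "(\<Sum>i\<in>A. x i * y i) < (\<Sum>i\<in>A. \<bar>x i\<bar> * \<bar>y i\<bar>)"
    by (intro sum_strict_mono_ex1) auto
  also have "\<dots> \<le> L2_set x A * L2_set y A"
    by (rule L2_set_mult_ineq)
  finally show "(L2_set (\<lambda>i. x i + y i) A)\<^sup>2 < (L2_set x A + L2_set y A)\<^sup>2"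
    by (simp add: L2_set_power2 power2_sum sum.distrib mult.assoc flip: sum_distrib_left)
qed simp

lemma L2_set_sum_less:
  assumes "finite J" "a \<in> J" "b \<in> J" and coords: "finite A" "k \<in> A" and signs: "u a k > 0" "u b k < 0"
  shows "L2_set (\<lambda>i. \<Sum>j\<in>J. u j i) A < (\<Sum>j\<in>J. L2_set (u j) A)"
proof -
  have "a \<noteq> b" using signs by auto
  then have split: "(\<Sum>j\<in>J. f j) = f a + f b + (\<Sum>j\<in>J - {a} - {b}. f j)" for f :: "_ \<Rightarrow> real"
    using assms(1-3) by (simp add: sum.remove[of J a] sum.remove[of "J - {a}" b])
  have "L2_set (\<lambda>i. \<Sum>j\<in>J. u j i) A
      \<le> L2_set (\<lambda>i. u a i + u b i) A + L2_set (\<lambda>i. \<Sum>j\<in>J - {a} - {b}. u j i) A"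
    unfolding split by (rule L2_set_triangle_ineq)
  also have "\<dots> < L2_set (u a) A + L2_set (u b) A + (\<Sum>j\<in>J - {a} - {b}. L2_set (u j) A)"
    by (intro add_less_le_mono L2_set_add_less[OF coords] L2_set_sum_le signs)
  finally show ?thesis by (simp only: split[of "\<lambda>j. L2_set (u j) A"])
qed

lemma sum_powr_convex_le:
  fixes x :: "'j \<Rightarrow> real"
  assumes "finite J" "J \<noteq> {}" and "\<And>j. j \<in> J \<Longrightarrow> c j \<ge> 0" "(\<Sum>j\<in>J. c j) = 1"
    and "\<And>j. j \<in> J \<Longrightarrow> x j \<ge> 0" and "s \<ge> 1"
  shows "(\<Sum>j\<in>J. c j * x j) powr s \<le> (\<Sum>j\<in>J. c j * x j powr s)"
  using convex_on_sum[of J "{0..}" "\<lambda>x. x powr s" c x] convex_on_powr[of s] assms by simp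

lemma L2_set_powr_convex_le:
  assumes "finite J" "J \<noteq> {}" and weights: "\<And>j. j \<in> J \<Longrightarrow> c j \<ge> 0" "(\<Sum>j\<in>J. c j) = 1"
    and s_ge_1: "s \<ge> 1"
  shows "L2_set (\<lambda>k. \<Sum>j\<in>J. c j * u j k) A powr s \<le> (\<Sum>j\<in>J. c j * L2_set (u j) A powr s)"
proof -
  have "L2_set (\<lambda>k. \<Sum>j\<in>J. c j * u j k) A \<le> (\<Sum>j\<in>J. L2_set (\<lambda>k. c j * u j k) A)"
    by (rule L2_set_sum_le)
  also have "\<dots> = (\<Sum>j\<in>J. c j * L2_set (u j) A)"
    using weights(1) by (intro sum.cong) (simp_all add: L2_set_cmult)
  finally have "L2_set (\<lambda>k. \<Sum>j\<in>J. c j * u j k) A powr s \<le> (\<Sum>j\<in>J. c j * L2_set (u j) A) powr s"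
    using s_ge_1 by (intro powr_mono2) simp_all
  also have "\<dots> \<le> (\<Sum>j\<in>J. c j * L2_set (u j) A powr s)"
    using assms by (intro sum_powr_convex_le) simp_all
  finally show ?thesis .
qed

lemma L2_set_powr_convex_less:
  assumes indices: "finite J" "i \<in> J" "j \<in> J" and weights: "\<And>j. j \<in> J \<Longrightarrow> c j > 0" "(\<Sum>j\<in>J. c j) = 1"
    and s_ge_1: "s \<ge> 1" and coords: "finite A" "k \<in> A" and signs: "u i k > 0" "u j k < 0"
  shows "L2_set (\<lambda>k. \<Sum>j\<in>J. c j * u j k) A powr s < (\<Sum>j\<in>J. c j * L2_set (u j) A powr s)"
proof -
  have "c i * u i k > 0" "c j * u j k < 0"
    using weights(1) indices signs by (simp_all add: mult_pos_neg)
  then have "L2_set (\<lambda>k. \<Sum>j\<in>J. c j * u j k) A < (\<Sum>j\<in>J. L2_set (\<lambda>k. c j * u j k) A)"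
    by (rule L2_set_sum_less[OF indices coords])
  also have "\<dots> = (\<Sum>j\<in>J. c j * L2_set (u j) A)"
    using weights(1) by (intro sum.cong) (simp_all add: L2_set_cmult less_imp_le)
  finally have "L2_set (\<lambda>k. \<Sum>j\<in>J. c j * u j k) A powr s < (\<Sum>j\<in>J. c j * L2_set (u j) A) powr s"
    using s_ge_1 by (intro powr_less_mono2) simp_all
  also have "\<dots> \<le> (\<Sum>j\<in>J. c j * L2_set (u j) A powr s)"
    using assms by (intro sum_powr_convex_le) (auto intro: less_imp_le)
  finally show ?thesis .
qed

section \<open>Product probability spaces\<close>

context product_prob_space
begin

lemma measurable_merge_PiM:
  assumes "J \<subseteq> I"
  shows "merge J (I - J) \<in> PiM I M \<Otimes>\<^sub>M PiM I M \<rightarrow>\<^sub>M PiM I M"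
proof (rule measurable_PiM_single')
  show "(\<lambda>x. merge J (I - J) x i) \<in> PiM I M \<Otimes>\<^sub>M PiM I M \<rightarrow>\<^sub>M M i" if "i \<in> I" for i
    using that assms by (cases "i \<in> J") (simp_all add: merge_def case_prod_beta')
  show "merge J (I - J) \<in> space (PiM I M \<Otimes>\<^sub>M PiM I M) \<rightarrow> (\<Pi>\<^sub>E i\<in>I. space (M i))"
    using assms by (auto simp: space_pair_measure space_PiM merge_def PiE_iff extensional_def)
qed

lemma distr_merge_PiM:
  assumes "J \<subseteq> I"
  shows "distr (PiM I M \<Otimes>\<^sub>M PiM I M) (PiM I M) (merge J (I - J)) = PiM I M"
proof (rule PiM_eq)
  fix K F assume K_subset: "finite K" "K \<subseteq> I" and F_sets: "\<And>j. j \<in> K \<Longrightarrow> F j \<in> sets (M j)"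
  have "merge J (I - J) -` emb I K (Pi\<^sub>E K F) \<inter> space (PiM I M \<Otimes>\<^sub>M PiM I M)
      = emb I (K \<inter> J) (Pi\<^sub>E (K \<inter> J) F) \<times> emb I (K - J) (Pi\<^sub>E (K - J) F)"
    using K_subset(2) assms
    by (fastforce simp: prod_emb_def space_pair_measure space_PiM PiE_iff merge_def extensional_def
        subset_iff split: if_splits)
  then have "emeasure (distr (PiM I M \<Otimes>\<^sub>M PiM I M) (PiM I M) (merge J (I - J))) (emb I K (Pi\<^sub>E K F))
      = emeasure (PiM I M \<Otimes>\<^sub>M PiM I M)
          (emb I (K \<inter> J) (Pi\<^sub>E (K \<inter> J) F) \<times> emb I (K - J) (Pi\<^sub>E (K - J) F))"
    using K_subset F_sets by (simp add: emeasure_distr[OF measurable_merge_PiM[OF assms]] sets_PiM_I)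
  also have "\<dots> = emeasure (PiM I M) (emb I (K \<inter> J) (Pi\<^sub>E (K \<inter> J) F))
      * emeasure (PiM I M) (emb I (K - J) (Pi\<^sub>E (K - J) F))"
    using K_subset F_sets by (intro P.emeasure_pair_measure_Times sets_PiM_I) auto
  also have "\<dots> = (\<Prod>j\<in>K \<inter> J. emeasure (M j) (F j)) * (\<Prod>j\<in>K - J. emeasure (M j) (F j))"
    using K_subset F_sets by (intro arg_cong2[where f="(*)"] emeasure_PiM_emb) auto
  also have "\<dots> = (\<Prod>j\<in>K. emeasure (M j) (F j))"
    by (rule prod.Int_Diff[OF K_subset(1), symmetric])
  finally show "emeasure (distr (PiM I M \<Otimes>\<^sub>M PiM I M) (PiM I M) (merge J (I - J))) (emb I K (Pi\<^sub>E K F))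
      = (\<Prod>j\<in>K. emeasure (M j) (F j))" .
qed simp

lemma nn_integral_PiM_merge:
  assumes "J \<subseteq> I" and f_measurable: "f \<in> borel_measurable (PiM I M)"
  shows "(\<integral>\<^sup>+x. f x \<partial>PiM I M) = (\<integral>\<^sup>+x. \<integral>\<^sup>+y. f (merge J (I - J) (x, y)) \<partial>PiM I M \<partial>PiM I M)"
proof -
  note merge [measurable] = measurable_merge_PiM[OF assms(1)]
  have "(\<integral>\<^sup>+x. f x \<partial>PiM I M) = (\<integral>\<^sup>+z. f (merge J (I - J) z) \<partial>(PiM I M \<Otimes>\<^sub>M PiM I M))"
    using nn_integral_distr[OF merge, of f] f_measurable by (simp add: distr_merge_PiM[OF assms(1)])
  also have "\<dots> = (\<integral>\<^sup>+x. \<integral>\<^sup>+y. f (merge J (I - J) (x, y)) \<partial>PiM I M \<partial>PiM I M)"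
    using measurable_compose[OF merge f_measurable] by (rule P.nn_integral_fst[symmetric])
  finally show ?thesis .
qed

lemma nn_integral_PiM_component:
  assumes "i \<in> I" "f \<in> borel_measurable (M i)"
  shows "(\<integral>\<^sup>+x. f (x i) \<partial>PiM I M) = (\<integral>\<^sup>+y. f y \<partial>M i)"
  using nn_integral_distr[OF measurable_component_singleton[OF assms(1)], of f M] assms
  by (simp add: PiM_component)

lemma nn_integral_PiM_fun_upd:
  assumes i_mem: "i \<in> I" and [measurable]: "f \<in> borel_measurable (PiM I M)"
  shows "(\<integral>\<^sup>+x. f x \<partial>PiM I M) = (\<integral>\<^sup>+x. \<integral>\<^sup>+y. f (x(i := y)) \<partial>M i \<partial>PiM I M)"
proof -
  have merge: "merge (I - {i}) (I - (I - {i})) (x, y) = x(i := y i)"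
    if "x \<in> space (PiM I M)" for x y
    using that i_mem by (auto simp: merge_def space_PiM PiE_iff extensional_def fun_eq_iff)
  have "(\<integral>\<^sup>+x. f x \<partial>PiM I M) = (\<integral>\<^sup>+x. \<integral>\<^sup>+y. f (x(i := y i)) \<partial>PiM I M \<partial>PiM I M)"
    using i_mem
    by (subst nn_integral_PiM_merge[of "I - {i}"]) (auto simp: merge cong: nn_integral_cong_simp)
  also have "\<dots> = (\<integral>\<^sup>+x. \<integral>\<^sup>+y. f (x(i := y)) \<partial>M i \<partial>PiM I M)"
  proof (rule nn_integral_cong)
    fix x assume x_space: "x \<in> space (PiM I M)"
    have "(\<lambda>y. x(i := y)) \<in> M i \<rightarrow>\<^sub>M PiM I M"
      using x_space i_mem by (intro measurable_fun_upd[where J=I]) auto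
    then show "(\<integral>\<^sup>+y. f (x(i := y i)) \<partial>PiM I M) = (\<integral>\<^sup>+y. f (x(i := y)) \<partial>M i)"
      by (intro nn_integral_PiM_component[OF i_mem]) measurable
  qed
  finally show ?thesis .
qed

lemma AE_PiM_fun_upd:
  assumes i_mem: "i \<in> I" and [measurable]: "Measurable.pred (PiM I M) Q"
    and AE_component: "\<And>x. x \<in> space (PiM I M) \<Longrightarrow> AE y in M i. Q (x(i := y))"
  shows "AE x in PiM I M. Q x"
proof -
  let ?f = "\<lambda>x. if Q x then 0 else 1 :: ennreal"
  have "(\<integral>\<^sup>+x. ?f x \<partial>PiM I M) = (\<integral>\<^sup>+x. \<integral>\<^sup>+y. ?f (x(i := y)) \<partial>M i \<partial>PiM I M)"
    by (rule nn_integral_PiM_fun_upd[OF i_mem]) measurable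
  also have "\<dots> = (\<integral>\<^sup>+x. \<integral>\<^sup>+y. 0 \<partial>M i \<partial>PiM I M)"
  proof (rule nn_integral_cong, rule nn_integral_cong_AE)
    fix x assume "x \<in> space (PiM I M)"
    then show "AE y in M i. ?f (x(i := y)) = 0"
      using AE_component[of x] by (auto elim: eventually_mono)
  qed
  finally have "AE x in PiM I M. ?f x = 0"
    by (simp add: nn_integral_0_iff_AE)
  then show ?thesis by eventually_elim (simp split: if_splits)
qed

lemma nn_integral_PiM_prod:
  assumes J_subset: "finite J" "J \<subseteq> I"
    and f_measurable [measurable]: "\<And>j. j \<in> J \<Longrightarrow> f j \<in> borel_measurable (M j)"
  shows "(\<integral>\<^sup>+x. (\<Prod>j\<in>J. f j (x j)) \<partial>PiM I M) = (\<Prod>j\<in>J. \<integral>\<^sup>+y. f j y \<partial>M j)"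
proof -
  have [measurable]: "(\<lambda>x. \<Prod>j\<in>J. f j (x j)) \<in> borel_measurable (PiM J M)"
    by measurable
  have "(\<integral>\<^sup>+x. (\<Prod>j\<in>J. f j (restrict x J j)) \<partial>PiM I M)
      = (\<integral>\<^sup>+x. (\<Prod>j\<in>J. f j (x j)) \<partial>distr (PiM I M) (PiM J M) (\<lambda>x. restrict x J))"
    by (intro nn_integral_distr[symmetric] measurable_restrict_subset J_subset(2)) measurable
  also have "\<dots> = (\<integral>\<^sup>+x. (\<Prod>j\<in>J. f j (x j)) \<partial>PiM J M)"
    by (simp only: distr_PiM_restrict_finite[OF J_subset])
  also have "\<dots> = (\<Prod>j\<in>J. \<integral>\<^sup>+y. f j y \<partial>M j)"
    by (rule product_nn_integral_prod[OF J_subset(1) f_measurable])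
  finally show ?thesis by simp
qed

lemma distr_PiM_map:
  assumes f_measurable [measurable]: "\<And>i. f i \<in> M i \<rightarrow>\<^sub>M M' i"
  shows "distr (PiM I M) (PiM I M') (\<lambda>x. \<lambda>i\<in>I. f i (x i)) = PiM I (\<lambda>i. distr (M i) (M' i) (f i))"
proof -
  interpret D: product_prob_space "\<lambda>i. distr (M i) (M' i) (f i)" I
    by (intro product_prob_spaceI M.prob_space_distr f_measurable)
  have sets: "sets (PiM I M') = sets (PiM I (\<lambda>i. distr (M i) (M' i) (f i)))"
    by (intro sets_PiM_cong) simp_all
  show ?thesis
  proof (rule D.PiM_eq)
    fix J F
    assume J_subset: "finite J" "J \<subseteq> I" and F_sets: "\<And>j. j \<in> J \<Longrightarrow> F j \<in> sets (distr (M j) (M' j) (f j))"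
    have "(\<lambda>x. \<lambda>i\<in>I. f i (x i)) -` D.emb I J (Pi\<^sub>E J F) \<inter> space (PiM I M)
        = emb I J (\<Pi>\<^sub>E j\<in>J. f j -` F j \<inter> space (M j))"
      using J_subset(2) measurable_space[OF f_measurable]
      by (auto simp: prod_emb_def space_PiM PiE_iff subset_iff)
    then have "emeasure (distr (PiM I M) (PiM I M') (\<lambda>x. \<lambda>i\<in>I. f i (x i))) (D.emb I J (Pi\<^sub>E J F))
        = emeasure (PiM I M) (emb I J (\<Pi>\<^sub>E j\<in>J. f j -` F j \<inter> space (M j)))"
      using J_subset F_sets by (subst emeasure_distr) (simp_all add: sets sets_PiM_I)
    also have "\<dots> = (\<Prod>j\<in>J. emeasure (M j) (f j -` F j \<inter> space (M j)))"
      using J_subset F_sets by (intro emeasure_PiM_emb measurable_sets[OF f_measurable]) auto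
    also have "\<dots> = (\<Prod>j\<in>J. emeasure (distr (M j) (M' j) (f j)) (F j))"
      using F_sets by (intro prod.cong) (simp_all add: emeasure_distr)
    finally show "emeasure (distr (PiM I M) (PiM I M') (\<lambda>x. \<lambda>i\<in>I. f i (x i))) (D.emb I J (Pi\<^sub>E J F))
        = (\<Prod>j\<in>J. emeasure (distr (M j) (M' j) (f j)) (F j))" .
  qed (simp add: sets)
qed

end

lemma sets_PiM_UNIV_borel:
  fixes M :: "'i::countable \<Rightarrow> 'a::second_countable_topology measure"
  assumes "\<And>i. sets (M i) = sets borel"
  shows "sets (PiM UNIV M) = sets borel"
  using sets_PiM_cong[OF refl, of UNIV M "\<lambda>_. borel"] assms by (simp add: sets_PiM_equal_borel)

lemma emeasure_PiM_open_pos: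
  fixes M :: "'i::countable \<Rightarrow> 'a::second_countable_topology measure"
  assumes prob: "\<And>i. prob_space (M i)" and sets: "\<And>i. sets (M i) = sets borel"
    and open_pos: "\<And>i U. open U \<Longrightarrow> U \<noteq> {} \<Longrightarrow> emeasure (M i) U \<noteq> 0"
    and U_open: "open U" "U \<noteq> {}"
  shows "emeasure (PiM UNIV M) U \<noteq> 0"
proof -
  interpret prob_space "M i" for i by (rule prob)
  interpret product_prob_space M UNIV by unfold_locales
  obtain x where "x \<in> U" using U_open(2) by auto
  then obtain X
    where X_box: "x \<in> Pi\<^sub>E UNIV X" "\<And>i. open (X i)" "finite {i. X i \<noteq> UNIV}" "Pi\<^sub>E UNIV X \<subseteq> U"
    using product_topology_open_contains_basis[of "\<lambda>_. euclidean" UNIV U x] U_open(1)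
    by (auto simp: open_fun_def)
  define J where "J = {i. X i \<noteq> UNIV}"
  have "Pi\<^sub>E UNIV X = emb UNIV J (Pi\<^sub>E J X)"
    using sets_eq_imp_space_eq[OF sets] by (fastforce simp: J_def prod_emb_def PiE_iff)
  then have "emeasure (PiM UNIV M) (Pi\<^sub>E UNIV X) = (\<Prod>i\<in>J. emeasure (M i) (X i))"
    using X_box(2,3) sets by (simp only:) (intro emeasure_PiM_emb, auto simp: J_def)
  moreover have "X i \<noteq> {}" for i using X_box(1) by auto
  ultimately have "emeasure (PiM UNIV M) (Pi\<^sub>E UNIV X) \<noteq> 0"
    using X_box(2,3) open_pos by (simp add: J_def)
  moreover have "U \<in> sets (PiM UNIV M)"
    using U_open(1) sets_PiM_UNIV_borel[of M] sets by simp
  ultimately show ?thesis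
    using emeasure_mono[OF X_box(4), of "PiM UNIV M"] by auto
qed

section \<open>Gaussian data\<close>

lemma nn_integral_lborel_shear_snd:
  fixes F :: "real \<Rightarrow> real \<Rightarrow> ennreal"
  assumes [measurable]: "case_prod F \<in> borel_measurable (borel \<Otimes>\<^sub>M borel)"
  shows "(\<integral>\<^sup>+x. \<integral>\<^sup>+y. F x (y + r * x) \<partial>lborel \<partial>lborel) = (\<integral>\<^sup>+x. \<integral>\<^sup>+y. F x y \<partial>lborel \<partial>lborel)"
proof (rule nn_integral_cong)
  show "(\<integral>\<^sup>+y. F x (y + r * x) \<partial>lborel) = (\<integral>\<^sup>+y. F x y \<partial>lborel)" for x
    using nn_integral_real_affine[of "F x" 1 "r * x"] by (simp add: add.commute)
qed

lemma nn_integral_lborel_shear_fst: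
  fixes F :: "real \<Rightarrow> real \<Rightarrow> ennreal"
  assumes [measurable]: "case_prod F \<in> borel_measurable (borel \<Otimes>\<^sub>M borel)"
  shows "(\<integral>\<^sup>+x. \<integral>\<^sup>+y. F (x + r * y) y \<partial>lborel \<partial>lborel) = (\<integral>\<^sup>+x. \<integral>\<^sup>+y. F x y \<partial>lborel \<partial>lborel)"
proof -
  have swap: "(\<integral>\<^sup>+x. \<integral>\<^sup>+y. G x y \<partial>lborel \<partial>lborel) = (\<integral>\<^sup>+y. \<integral>\<^sup>+x. G x y \<partial>lborel \<partial>lborel)"
    if [measurable]: "case_prod G \<in> borel_measurable (borel \<Otimes>\<^sub>M borel)" for G :: "real \<Rightarrow> real \<Rightarrow> ennreal"
    by (intro lborel_pair.Fubini') simp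
  show ?thesis
    using nn_integral_lborel_shear_snd[of "\<lambda>y x. F x y" r] by (subst (1 2) swap) simp_all
qed

text \<open>A rotation with nonzero sine is a product of three shears.\<close>

lemma nn_integral_lborel_rotate:
  fixes F :: "real \<Rightarrow> real \<Rightarrow> ennreal" and c s :: real
  assumes [measurable]: "case_prod F \<in> borel_measurable (borel \<Otimes>\<^sub>M borel)"
    and cos_sin: "c\<^sup>2 + s\<^sup>2 = 1" "s \<noteq> 0"
  shows "(\<integral>\<^sup>+x. \<integral>\<^sup>+y. F (c * x - s * y) (s * x + c * y) \<partial>lborel \<partial>lborel)
       = (\<integral>\<^sup>+x. \<integral>\<^sup>+y. F x y \<partial>lborel \<partial>lborel)"
proof -
  define t where "t = (c - 1) / s"
  define G where "G x y = F (x + t * y) y" for x y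
  define H where "H x y = G x (y + s * x)" for x y
  have [measurable]: "case_prod G \<in> borel_measurable (borel \<Otimes>\<^sub>M borel)"
    unfolding G_def by simp
  have [measurable]: "case_prod H \<in> borel_measurable (borel \<Otimes>\<^sub>M borel)"
    unfolding H_def by simp
  have "F (c * x - s * y) (s * x + c * y) = H (x + t * y) y" for x y
  proof -
    have t_identities: "t * s = c - 1" "t * (1 + c) = - s"
      using cos_sin by (simp_all add: t_def field_simps power2_eq_square)
    have "y + s * (x + t * y) = s * x + (1 + t * s) * y"
      by (simp add: algebra_simps)
    moreover have "x + t * y + t * (s * x + c * y) = (1 + t * s) * x + t * (1 + c) * y"
      by (simp add: algebra_simps)
    ultimately show ?thesis
      by (simp add: G_def H_def t_identities)
  qed
  then have "(\<integral>\<^sup>+x. \<integral>\<^sup>+y. F (c * x - s * y) (s * x + c * y) \<partial>lborel \<partial>lborel)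
      = (\<integral>\<^sup>+x. \<integral>\<^sup>+y. H (x + t * y) y \<partial>lborel \<partial>lborel)"
    by simp
  also have "\<dots> = (\<integral>\<^sup>+x. \<integral>\<^sup>+y. H x y \<partial>lborel \<partial>lborel)"
    by (rule nn_integral_lborel_shear_fst) measurable
  also have "\<dots> = (\<integral>\<^sup>+x. \<integral>\<^sup>+y. G x y \<partial>lborel \<partial>lborel)"
    unfolding H_def by (rule nn_integral_lborel_shear_snd) measurable
  also have "\<dots> = (\<integral>\<^sup>+x. \<integral>\<^sup>+y. F x y \<partial>lborel \<partial>lborel)"
    unfolding G_def by (rule nn_integral_lborel_shear_fst) measurable
  finally show ?thesis .
qed

lemma normal_density_rotate:
  assumes "c\<^sup>2 + s\<^sup>2 = 1"
  shows "normal_density 0 \<sigma> (c * x - s * y) * normal_density 0 \<sigma> (s * x + c * y)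
    = normal_density 0 \<sigma> x * normal_density 0 \<sigma> y"
proof -
  have "(c * x - s * y)\<^sup>2 + (s * x + c * y)\<^sup>2 = (c\<^sup>2 + s\<^sup>2) * (x\<^sup>2 + y\<^sup>2)"
    by (simp add: power2_eq_square algebra_simps)
  moreover have "normal_density 0 \<sigma> x * normal_density 0 \<sigma> y
      = (1 / sqrt (2 * pi * \<sigma>\<^sup>2))\<^sup>2 * exp (- (x\<^sup>2 + y\<^sup>2) / (2 * \<sigma>\<^sup>2))" for x y
    by (simp add: normal_density_def power2_eq_square mult_exp_exp add_divide_distrib
        diff_divide_distrib)
  ultimately show ?thesis
    using assms by simp
qed

definition plane_rotation :: "real \<Rightarrow> real \<Rightarrow> 'i \<Rightarrow> 'i \<Rightarrow> ('i \<Rightarrow> real) \<Rightarrow> 'i \<Rightarrow> real" where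
  "plane_rotation c s p q u = u(p := c * u p - s * u q, q := s * u p + c * u q)"

locale gaussian_data =
  fixes v :: real
  assumes v_pos: "v > 0"
begin

abbreviation N :: "real measure" where
  "N \<equiv> density lborel (normal_density 0 (sqrt v))"

abbreviation P :: "(nat \<times> nat \<Rightarrow> real) measure" where
  "P \<equiv> PiM UNIV (\<lambda>_. N)"

sublocale N: prob_space N
  using v_pos by (intro prob_space_normal_density) simp

sublocale data: product_prob_space "\<lambda>_ :: nat \<times> nat. N" UNIV
  by unfold_locales

lemma data_space_eq: "data_space v = P"
  by (simp add: data_space_def)

lemma space_P [simp]: "space P = UNIV"
  by (simp add: space_PiM PiE_UNIV_domain)

lemma sets_P [measurable_cong]: "sets P = sets borel"
  by (intro sets_PiM_UNIV_borel) simp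

lemma continuous_imp_measurable_P:
  fixes f :: "(nat \<times> nat \<Rightarrow> real) \<Rightarrow> 'a::topological_space"
  assumes "continuous_on UNIV f"
  shows "f \<in> borel_measurable P"
  using borel_measurable_continuous_onI[OF assms] by (simp add: measurable_cong_sets[OF sets_P refl])

lemma nn_integral_N_rotate:
  fixes F :: "real \<Rightarrow> real \<Rightarrow> ennreal"
  assumes [measurable]: "case_prod F \<in> borel_measurable (borel \<Otimes>\<^sub>M borel)"
    and cos_sin: "c\<^sup>2 + s\<^sup>2 = 1" "s \<noteq> 0"
  shows "(\<integral>\<^sup>+x. \<integral>\<^sup>+y. F (c * x - s * y) (s * x + c * y) \<partial>N \<partial>N) = (\<integral>\<^sup>+x. \<integral>\<^sup>+y. F x y \<partial>N \<partial>N)"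
proof -
  let ?n = "normal_density 0 (sqrt v)"
  define G where "G x y = ennreal (?n x * ?n y) * F x y" for x y
  have [measurable]: "case_prod G \<in> borel_measurable (borel \<Otimes>\<^sub>M borel)"
    unfolding G_def by measurable
  have iterated_density: "(\<integral>\<^sup>+x. \<integral>\<^sup>+y. H x y \<partial>N \<partial>N)
      = (\<integral>\<^sup>+x. \<integral>\<^sup>+y. ennreal (?n x * ?n y) * H x y \<partial>lborel \<partial>lborel)"
    if [measurable]: "case_prod H \<in> borel_measurable (borel \<Otimes>\<^sub>M borel)" for H :: "real \<Rightarrow> real \<Rightarrow> ennreal"
    by (simp add: nn_integral_density ennreal_mult' mult.assoc flip: nn_integral_cmult)
  have "(\<integral>\<^sup>+x. \<integral>\<^sup>+y. F (c * x - s * y) (s * x + c * y) \<partial>N \<partial>N)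
      = (\<integral>\<^sup>+x. \<integral>\<^sup>+y. G (c * x - s * y) (s * x + c * y) \<partial>lborel \<partial>lborel)"
    unfolding G_def normal_density_rotate[OF cos_sin(1)] by (rule iterated_density) measurable
  also have "\<dots> = (\<integral>\<^sup>+x. \<integral>\<^sup>+y. G x y \<partial>lborel \<partial>lborel)"
    by (rule nn_integral_lborel_rotate[OF _ cos_sin]) measurable
  also have "\<dots> = (\<integral>\<^sup>+x. \<integral>\<^sup>+y. F x y \<partial>N \<partial>N)"
    unfolding G_def by (rule iterated_density[symmetric]) measurable
  finally show ?thesis .
qed

lemma measurable_plane_rotation [measurable]: "plane_rotation c s p q \<in> P \<rightarrow>\<^sub>M P"
  unfolding plane_rotation_def by (intro measurable_fun_upd[where J=UNIV]) simp_all

lemma nn_integral_plane_rotation: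
  assumes f_measurable [measurable]: "f \<in> borel_measurable P" and p_neq_q: "p \<noteq> q"
    and cos_sin: "c\<^sup>2 + s\<^sup>2 = 1" "s \<noteq> 0"
  shows "(\<integral>\<^sup>+w. f (plane_rotation c s p q w) \<partial>P) = (\<integral>\<^sup>+w. f w \<partial>P)"
proof -
  have resample: "(\<integral>\<^sup>+w. g w \<partial>P) = (\<integral>\<^sup>+w. \<integral>\<^sup>+x. \<integral>\<^sup>+y. g (w(p := x, q := y)) \<partial>N \<partial>N \<partial>P)"
    if [measurable]: "g \<in> borel_measurable P" for g :: "_ \<Rightarrow> ennreal"
  proof -
    have [measurable]: "(\<lambda>(w, y). g (w(q := y))) \<in> borel_measurable (P \<Otimes>\<^sub>M N)"
      using measurable_add_dim[of q UNIV "\<lambda>_. N"] by simp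
    have "(\<integral>\<^sup>+w. g w \<partial>P) = (\<integral>\<^sup>+w. \<integral>\<^sup>+y. g (w(q := y)) \<partial>N \<partial>P)"
      by (rule data.nn_integral_PiM_fun_upd) simp_all
    also have "\<dots> = (\<integral>\<^sup>+w. \<integral>\<^sup>+x. \<integral>\<^sup>+y. g (w(p := x, q := y)) \<partial>N \<partial>N \<partial>P)"
      by (rule data.nn_integral_PiM_fun_upd) simp_all
    finally show ?thesis .
  qed
  have f_upd_measurable [measurable]:
    "(\<lambda>z. f (w(p := fst z, q := snd z))) \<in> borel_measurable (borel \<Otimes>\<^sub>M borel)" for w
    by (rule measurable_compose[OF _ f_measurable]) (intro measurable_fun_upd[where J=UNIV], simp_all)
  have rotate: "plane_rotation c s p q (w(p := x, q := y)) = w(p := c * x - s * y, q := s * x + c * y)"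
    for w x y
    using p_neq_q by (simp add: plane_rotation_def fun_upd_twist)
  have "(\<integral>\<^sup>+w. f (plane_rotation c s p q w) \<partial>P)
      = (\<integral>\<^sup>+w. \<integral>\<^sup>+x. \<integral>\<^sup>+y. f (w(p := c * x - s * y, q := s * x + c * y)) \<partial>N \<partial>N \<partial>P)"
    by (subst resample) (simp_all add: rotate)
  also have "\<dots> = (\<integral>\<^sup>+w. \<integral>\<^sup>+x. \<integral>\<^sup>+y. f (w(p := x, q := y)) \<partial>N \<partial>N \<partial>P)"
    using f_upd_measurable
    by (intro nn_integral_cong nn_integral_N_rotate[OF _ cos_sin]) (simp add: case_prod_beta')
  also have "\<dots> = (\<integral>\<^sup>+w. f w \<partial>P)"
    by (rule resample[symmetric]) simp
  finally show ?thesis .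
qed

lemma emeasure_N_open_pos:
  assumes "open U" "U \<noteq> {}"
  shows "emeasure N U \<noteq> 0"
proof
  assume "emeasure N U = 0"
  then have "AE x in lborel. x \<in> U \<longrightarrow> normal_density 0 (sqrt v) x = 0"
    using assms null_sets_density_iff[of "normal_density 0 (sqrt v)" lborel U] by auto
  moreover have "normal_density 0 (sqrt v) x \<noteq> 0" for x
    using v_pos normal_density_pos[of "sqrt v" 0 x] by simp
  ultimately have "AE x in lborel. x \<notin> U"
    by simp
  then have "negligible U"
    using assms(1) AE_iff_null_sets[of U lborel]
    by (simp add: negligible_iff_null_sets null_sets_completionI)
  then show False
    using open_not_negligible assms by blast
qed

lemma emeasure_P_open_pos:
  assumes "open U" "w \<in> U"
  shows "emeasure P U \<noteq> 0"
  using assms emeasure_N_open_pos N.prob_space_axioms by (intro emeasure_PiM_open_pos) auto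

end

section \<open>Power moments of a positive random variable\<close>

definition power_moment :: "'a measure \<Rightarrow> ('a \<Rightarrow> real) \<Rightarrow> real \<Rightarrow> real" where
  "power_moment M R s = (\<integral>x. R x powr s \<partial>M)"

definition log_mean :: "'a measure \<Rightarrow> ('a \<Rightarrow> real) \<Rightarrow> real" where
  "log_mean M R = (\<integral>x. ln (R x) \<partial>M)"

lemma abs_le_exp_plus_exp:
  fixes r y :: real
  assumes "r > 0"
  shows "\<bar>y\<bar> \<le> (exp (r * y) + exp (- r * y)) / r"
proof -
  have "\<bar>r * y\<bar> \<le> exp (r * y) + exp (- (r * y))"
    using exp_ge_add_one_self[of "r * y"] exp_ge_add_one_self[of "- (r * y)"]
      exp_gt_zero[of "r * y"] exp_gt_zero[of "- (r * y)"] by linarith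
  then show ?thesis using assms by (simp add: abs_mult field_simps)
qed

lemma abs_exp_slope_le:
  fixes r s y :: real
  assumes "s \<noteq> 0" "\<bar>s\<bar> \<le> r"
  shows "\<bar>(exp (s * y) - 1) / s\<bar> \<le> (exp (r * y) + exp (- r * y)) / r"
proof -
  have positive_case: "\<bar>(exp (s * y) - 1) / s\<bar> \<le> (exp (r * y) + exp (- r * y)) / r"
    if "0 < s" "s \<le> r" for s y :: real
  proof (rule abs_leI)
    have r_pos: "r > 0" using that by simp
    have "exp (s * y) - 1 \<le> (exp (r * y) - 1) / r * s"
      using convex_onD[OF exp_convex, of "s / r" 0 "r * y"] that r_pos
      by (simp add: algebra_simps diff_divide_distrib)
    then have "(exp (s * y) - 1) / s \<le> (exp (r * y) - 1) / r"
      using that by (simp add: pos_divide_le_eq)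
    also have "\<dots> \<le> (exp (r * y) + exp (- r * y)) / r"
      using r_pos by (intro divide_right_mono) (simp_all add: add_increasing2)
    finally show "(exp (s * y) - 1) / s \<le> (exp (r * y) + exp (- r * y)) / r" .
    have "- ((exp (s * y) - 1) / s) \<le> - y"
      using exp_ge_add_one_self[of "s * y"] that by (simp add: field_simps)
    also have "\<dots> \<le> (exp (r * y) + exp (- r * y)) / r"
      using abs_le_exp_plus_exp[OF r_pos, of y] by linarith
    finally show "- ((exp (s * y) - 1) / s) \<le> (exp (r * y) + exp (- r * y)) / r" .
  qed
  show ?thesis
    using positive_case[of s y] positive_case[of "- s" "- y"] assms
    by (cases "s > 0") (auto simp: add.commute)
qed

lemma (in prob_space) AE_eventually_less_power:
  fixes Z :: "nat \<Rightarrow> 'a \<Rightarrow> real"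
  assumes [measurable]: "\<And>k. Z k \<in> borel_measurable M"
    and moment: "\<And>k. (\<integral>\<^sup>+x. ennreal (Z k x) \<partial>M) \<le> ennreal (q ^ k)" and q_bounds: "0 \<le> q" "q < c"
  shows "AE x in M. \<forall>\<^sub>F k in sequentially. Z k x < c ^ k"
proof -
  define A where "A k = {x \<in> space M. c ^ k \<le> Z k x}" for k
  have c_pos: "c > 0" using q_bounds by simp
  have [measurable]: "A k \<in> sets M" for k
    unfolding A_def by measurable
  have markov: "prob (A k) \<le> (q / c) ^ k" for k
  proof -
    have "c ^ k \<le> z \<longleftrightarrow> 1 \<le> ennreal (1 / c ^ k) * ennreal z" for z
      using c_pos by (subst ennreal_mult'[symmetric]) (simp_all add: ennreal_ge_1 field_simps)
    then have "emeasure M (A k)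
        \<le> ennreal (1 / c ^ k) * (\<integral>\<^sup>+x. ennreal (Z k x) * indicator (space M) x \<partial>M)"
      using nn_integral_Markov_inequality[of "\<lambda>x. ennreal (Z k x)" "space M" M "ennreal (1 / c ^ k)"]
      by (simp add: A_def)
    also have "\<dots> \<le> ennreal (1 / c ^ k) * ennreal (q ^ k)"
      using moment[of k] by (intro mult_left_mono) simp_all
    also have "\<dots> = ennreal ((q / c) ^ k)"
      using c_pos by (simp add: ennreal_mult'[symmetric] power_divide)
    finally show ?thesis
      using q_bounds c_pos by (simp add: emeasure_eq_measure ennreal_le_iff)
  qed
  have "summable (\<lambda>k. prob (A k))"
  proof (rule summable_comparison_test')
    show "summable (\<lambda>k. (q / c) ^ k)"
      using q_bounds c_pos by (intro summable_geometric) simp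
    show "norm (prob (A k)) \<le> (q / c) ^ k" for k
      using markov[of k] by simp
  qed
  then have "AE x in M. \<forall>\<^sub>F k in sequentially. x \<in> space M - A k"
    by (intro borel_cantelli_AE1) (auto simp: emeasure_eq_measure)
  then show ?thesis
    by eventually_elim (auto simp: A_def not_le elim: eventually_mono)
qed

lemma powr_less_exp_power_iff:
  fixes s x y :: real
  assumes "x > 0"
  shows "x powr s < exp y ^ k \<longleftrightarrow> s * ln x < real k * y"
  using assms by (simp add: powr_def exp_of_nat_mult[symmetric])

locale positive_rv = prob_space +
  fixes R :: "'a \<Rightarrow> real" and \<delta> :: real
  assumes R_measurable [measurable]: "R \<in> borel_measurable M"
    and R_pos: "AE x in M. R x > 0"
    and \<delta>_pos: "\<delta> > 0"
    and integrable_powr: "s > - \<delta> \<Longrightarrow> integrable M (\<lambda>x. R x powr s)"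
begin

abbreviation g :: "real \<Rightarrow> real" where
  "g \<equiv> power_moment M R"

abbreviation \<gamma> :: real where
  "\<gamma> \<equiv> log_mean M R"

lemma AE_powr_eq_exp: "AE x in M. R x powr s = exp (s * ln (R x))"
  using R_pos by eventually_elim (simp add: powr_def)

lemma g_eq_exp: "g s = expectation (\<lambda>x. exp (s * ln (R x)))"
  unfolding power_moment_def using AE_powr_eq_exp by (intro integral_cong_AE) auto

lemma integrable_exp_ln: "s > - \<delta> \<Longrightarrow> integrable M (\<lambda>x. exp (s * ln (R x)))"
  using integrable_powr[of s] AE_powr_eq_exp[of s] by (subst integrable_cong_AE[symmetric]) auto

lemma g_0: "g 0 = 1"
  by (simp add: g_eq_exp prob_space)

lemma g_nonneg: "g s \<ge> 0"
  by (simp add: power_moment_def)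

lemma integrable_exp_plus_exp:
  "0 < r \<Longrightarrow> r < \<delta> \<Longrightarrow> integrable M (\<lambda>x. (exp (r * ln (R x)) + exp (- r * ln (R x))) / r)"
  using \<delta>_pos integrable_exp_ln[of r] integrable_exp_ln[of "- r"] by simp

lemma integrable_ln: "integrable M (\<lambda>x. ln (R x))"
proof (rule Bochner_Integration.integrable_bound)
  let ?r = "\<delta> / 2"
  show "integrable M (\<lambda>x. (exp (?r * ln (R x)) + exp (- ?r * ln (R x))) / ?r)"
    using \<delta>_pos by (intro integrable_exp_plus_exp) simp_all
  show "AE x in M. norm (ln (R x)) \<le> norm ((exp (?r * ln (R x)) + exp (- ?r * ln (R x))) / ?r)"
    using abs_le_exp_plus_exp[of ?r "ln (R x)" for x] \<delta>_pos
    by (intro AE_I2) (auto intro: order_trans[OF _ abs_ge_self])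
qed simp

lemma g_has_derivative_0: "(g has_real_derivative \<gamma>) (at 0)"
proof -
  define r where "r = \<delta> / 2"
  have r_bounds: "0 < r" "r < \<delta>" using \<delta>_pos by (simp_all add: r_def)
  define slope where "slope s y = (exp (s * y) - 1) / s" for s y :: real
  have slope_tendsto: "((\<lambda>s. slope s y) \<longlongrightarrow> y) (at 0)" for y
  proof -
    have "((\<lambda>s. exp (s * y)) has_real_derivative y) (at 0)"
      by (auto intro!: derivative_eq_intros)
    then show ?thesis by (simp add: has_field_derivative_iff slope_def)
  qed
  have g_slope: "(g s - g 0) / (s - 0) = expectation (\<lambda>x. slope s (ln (R x)))" if "\<bar>s\<bar> < r" for s
    using that r_bounds integrable_exp_ln[of s]
    by (simp add: slope_def g_0 prob_space) (simp add: g_eq_exp)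
  have "((\<lambda>s. (g s - g 0) / (s - 0)) \<longlongrightarrow> \<gamma>) (at 0 within {- r<..<r})"
    unfolding tendsto_at_iff_sequentially o_def
  proof (intro allI impI)
    fix X :: "nat \<Rightarrow> real"
    assume "\<forall>n. X n \<in> {- r<..<r} - {0}" and X_tendsto: "X \<longlonglongrightarrow> 0"
    then have X_bounds: "\<bar>X n\<bar> < r" "X n \<noteq> 0" for n
      by (auto simp: abs_less_iff minus_less_iff)
    have "(\<lambda>n. expectation (\<lambda>x. slope (X n) (ln (R x)))) \<longlonglongrightarrow> expectation (\<lambda>x. ln (R x))"
    proof (rule integral_dominated_convergence)
      show "integrable M (\<lambda>x. (exp (r * ln (R x)) + exp (- r * ln (R x))) / r)"
        by (rule integrable_exp_plus_exp[OF r_bounds])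
      have "filterlim X (at 0) sequentially"
        using X_bounds X_tendsto by (simp add: filterlim_at)
      then show "AE x in M. (\<lambda>n. slope (X n) (ln (R x))) \<longlonglongrightarrow> ln (R x)"
        by (intro AE_I2 filterlim_compose[OF slope_tendsto])
      show "AE x in M. norm (slope (X n) (ln (R x))) \<le> (exp (r * ln (R x)) + exp (- r * ln (R x))) / r"
        for n
        unfolding slope_def real_norm_def using X_bounds by (intro AE_I2 abs_exp_slope_le less_imp_le)
    qed (simp_all add: slope_def)
    then show "(\<lambda>n. (g (X n) - g 0) / (X n - 0)) \<longlonglongrightarrow> \<gamma>"
      using X_bounds by (simp only: g_slope log_mean_def)
  qed
  then show ?thesis
    using r_bounds by (simp add: has_field_derivative_iff at_within_open[of 0 "{- r<..<r}"])
qed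

lemma eventually_g_less_exp:
  assumes "\<epsilon> > 0"
  shows "\<forall>\<^sub>F s in at 0. g s < exp (s * \<gamma> + \<bar>s\<bar> * \<epsilon>)"
proof -
  have "((\<lambda>s. (g s - 1) / s) \<longlongrightarrow> \<gamma>) (at 0)"
    using g_has_derivative_0 by (simp add: has_field_derivative_iff g_0)
  then have "\<forall>\<^sub>F s in at 0. dist ((g s - 1) / s) \<gamma> < \<epsilon>"
    using assms by (rule tendstoD)
  then show ?thesis
    using eventually_neq_at_within[of 0]
  proof eventually_elim
    case (elim s)
    have "g s - 1 - s * \<gamma> = s * ((g s - 1) / s - \<gamma>)"
      using elim(2) by (simp add: field_simps)
    also have "\<dots> \<le> \<bar>s\<bar> * \<bar>(g s - 1) / s - \<gamma>\<bar>"
      by (metis abs_ge_self abs_mult)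
    also have "\<dots> < \<bar>s\<bar> * \<epsilon>"
      using elim by (intro mult_strict_left_mono) (simp_all add: dist_real_def)
    finally show "g s < exp (s * \<gamma> + \<bar>s\<bar> * \<epsilon>)"
      using exp_ge_add_one_self[of "s * \<gamma> + \<bar>s\<bar> * \<epsilon>"] by linarith
  qed
qed

lemma convex_on_g: "convex_on {- \<delta><..} g"
proof (rule convex_onI)
  fix t x y :: real
  assume t_bounds: "0 < t" "t < 1" and args_mem: "x \<in> {- \<delta><..}" "y \<in> {- \<delta><..}"
  have "(1 - t) *\<^sub>R x + t *\<^sub>R y \<in> {- \<delta><..}"
    using t_bounds args_mem by (intro convexD) simp_all
  then have "g ((1 - t) *\<^sub>R x + t *\<^sub>R y)
      \<le> expectation (\<lambda>w. (1 - t) * exp (x * ln (R w)) + t * exp (y * ln (R w)))"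
    unfolding g_eq_exp
  proof (intro integral_mono)
    show "exp (((1 - t) *\<^sub>R x + t *\<^sub>R y) * ln (R w))
        \<le> (1 - t) * exp (x * ln (R w)) + t * exp (y * ln (R w))" for w
      using convex_onD[OF exp_convex, of t "x * ln (R w)" "y * ln (R w)"] t_bounds
      by (simp add: algebra_simps)
  qed (use args_mem integrable_exp_ln in auto)
  also have "\<dots> = (1 - t) * g x + t * g y"
    using args_mem integrable_exp_ln by (simp add: g_eq_exp)
  finally show "g ((1 - t) *\<^sub>R x + t *\<^sub>R y) \<le> (1 - t) * g x + t * g y" .
qed simp

lemma continuous_on_g: "continuous_on {- \<delta><..} g"
  by (intro convex_on_continuous convex_on_g) simp

lemma ex_g_gt_1:
  assumes "emeasure M {x \<in> space M. R x > 1} \<noteq> 0"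
  shows "\<exists>s>0. 1 < g s"
proof -
  define A where "A = {x \<in> space M. R x > 1}"
  have [measurable]: "A \<in> sets M" by (simp add: A_def)
  define m where "m = expectation (\<lambda>x. ln (R x) * indicator A x)"
  have integrable_ln_A: "integrable M (\<lambda>x. ln (R x) * indicator A x)"
    by (intro integrable_mult_indicator[simplified mult.commute] integrable_real_mult_indicator
        integrable_ln) simp
  have "expectation (\<lambda>x. 0) < m"
    unfolding m_def using assms integrable_ln_A
    by (intro integral_less_AE[where A=A]) (auto simp: A_def indicator_def)
  then have m_pos: "m > 0" by simp
  have "1 < prob A + 1 / m * m"
    using assms m_pos by (simp add: A_def emeasure_eq_measure zero_less_measure_iff)
  also have "\<dots> = expectation (\<lambda>x. indicator A x + 1 / m * (ln (R x) * indicator A x))"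
    using integrable_ln_A by (subst Bochner_Integration.integral_add)
      (simp_all add: m_def integrable_real_indicator emeasure_eq_measure)
  also have "\<dots> \<le> g (1 / m)"
    unfolding power_moment_def
  proof (rule integral_mono)
    show "indicator A x + 1 / m * (ln (R x) * indicator A x) \<le> R x powr (1 / m)" if "x \<in> space M" for x
      using exp_ge_add_one_self[of "1 / m * ln (R x)"] by (auto simp: A_def indicator_def powr_def)
    show "integrable M (\<lambda>x. R x powr (1 / m))"
      using m_pos \<delta>_pos by (intro integrable_powr) (simp add: order_less_trans[of _ 0])
  qed (use integrable_ln_A in \<open>simp add: integrable_real_indicator emeasure_eq_measure\<close>)
  finally show ?thesis using m_pos by (intro exI[of _ "1 / m"]) simp
qed

lemma g_crosses_1:
  assumes "\<gamma> < 0" "emeasure M {x \<in> space M. R x > 1} \<noteq> 0"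
  obtains \<alpha> where "\<alpha> > 0" "\<And>s. s > 0 \<Longrightarrow> g s = 1 \<longleftrightarrow> s = \<alpha>" "\<And>s. s > 0 \<Longrightarrow> g s < 1 \<longleftrightarrow> s < \<alpha>"
proof -
  have "{0..} \<subseteq> {- \<delta><..}" using \<delta>_pos by auto
  then have convex_cont: "convex_on {0..} g" "continuous_on {0..} g"
    using convex_on_subset[OF convex_on_g] continuous_on_subset[OF continuous_on_g] by auto
  have "\<forall>\<^sub>F s in at_right 0. g s < exp (s * \<gamma> + \<bar>s\<bar> * - \<gamma>)"
    using assms(1) by (intro filter_leD[OF at_le eventually_g_less_exp]) auto
  then have "\<forall>\<^sub>F s in at_right 0. g s < 1"
    using eventually_at_right_less[of 0] by eventually_elim simp
  then obtain x where x_below: "0 < x" "g x < 1"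
    unfolding eventually_at_right_field by (metis dense)
  obtain y where y_above: "0 < y" "1 < g y"
    using ex_g_gt_1[OF assms(2)] by blast
  show ?thesis
    by (rule convex_on_level_crossing[OF convex_cont g_0 x_below y_above]) (rule that)
qed

lemma AE_eventually_ln_div_near:
  fixes X :: "nat \<Rightarrow> 'b \<Rightarrow> real"
  assumes "prob_space Q" and [measurable]: "\<And>k. X k \<in> borel_measurable Q"
    and X_pos: "AE x in Q. \<forall>k. X k x > 0"
    and moment: "\<And>k s. s > - \<delta> \<Longrightarrow> (\<integral>\<^sup>+x. ennreal (X k x powr s) \<partial>Q) \<le> ennreal (g s ^ k)"
    and "\<epsilon> > 0"
  shows "AE x in Q. \<forall>\<^sub>F k in sequentially. \<bar>ln (X k x) / real k - \<gamma>\<bar> < \<epsilon>"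
proof -
  interpret Q: prob_space Q by fact
  obtain d where "d > 0" and g_less_exp: "\<And>s. s \<noteq> 0 \<Longrightarrow> \<bar>s\<bar> < d \<Longrightarrow> g s < exp (s * \<gamma> + \<bar>s\<bar> * \<epsilon>)"
    using eventually_g_less_exp[OF \<open>\<epsilon> > 0\<close>] unfolding eventually_at by (auto simp: dist_real_def)
  define s where "s = min d \<delta> / 2"
  have s_bounds: "0 < s" "s < \<delta>" "s < d" using \<open>d > 0\<close> \<delta>_pos by (simp_all add: s_def min_def)
  have eventually_less: "AE x in Q. \<forall>\<^sub>F k in sequentially. X k x powr s' < exp (s' * \<gamma> + s * \<epsilon>) ^ k"
    if "\<bar>s'\<bar> = s" for s'
    using that s_bounds g_less_exp[of s'] g_nonneg
    by (intro Q.AE_eventually_less_power[where q="g s'"] moment) auto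
  have plus: "AE x in Q. \<forall>\<^sub>F k in sequentially. X k x powr s < exp (s * \<gamma> + s * \<epsilon>) ^ k"
    and minus: "AE x in Q. \<forall>\<^sub>F k in sequentially. X k x powr - s < exp (- s * \<gamma> + s * \<epsilon>) ^ k"
    using s_bounds by (intro eventually_less, simp)+
  show ?thesis
    using plus minus X_pos
  proof eventually_elim
    case (elim x)
    show ?case
      using elim(1,2) eventually_gt_at_top[of 0]
    proof eventually_elim
      case (elim k)
      have "s * ln (X k x) < real k * (s * \<gamma> + s * \<epsilon>)" "- s * ln (X k x) < real k * (- s * \<gamma> + s * \<epsilon>)"
        using elim(1,2) \<open>\<forall>k. X k x > 0\<close> by (simp_all add: powr_less_exp_power_iff)
      then have "s * ln (X k x) < s * (real k * (\<gamma> + \<epsilon>))" "s * (real k * (\<gamma> - \<epsilon>)) < s * ln (X k x)"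
        by (simp_all add: algebra_simps)
      then have "real k * (\<gamma> - \<epsilon>) < ln (X k x)" "ln (X k x) < real k * (\<gamma> + \<epsilon>)"
        using s_bounds(1) by (simp_all only: mult_less_cancel_left_pos)
      then have "\<gamma> - \<epsilon> < ln (X k x) / real k" "ln (X k x) / real k < \<gamma> + \<epsilon>"
        using elim(3) by (simp_all add: pos_less_divide_eq pos_divide_less_eq mult.commute)
      then show ?case by linarith
    qed
  qed
qed

lemma AE_ln_div_tendsto:
  fixes X :: "nat \<Rightarrow> 'b \<Rightarrow> real"
  assumes "prob_space Q" and [measurable]: "\<And>k. X k \<in> borel_measurable Q" and nonneg: "\<And>k x. X k x \<ge> 0"
    and moment: "\<And>k s. s > - \<delta> \<Longrightarrow> (\<integral>\<^sup>+x. ennreal (X k x powr s) \<partial>Q) = ennreal (g s ^ k)"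
  shows "AE x in Q. \<forall>k. X k x > 0"
    and "AE x in Q. (\<lambda>k. ln (X k x) / real k) \<longlonglongrightarrow> \<gamma>"
proof -
  interpret Q: prob_space Q by fact
  show X_pos: "AE x in Q. \<forall>k. X k x > 0"
    unfolding AE_all_countable
  proof
    fix k
    have "emeasure Q {x \<in> space Q. X k x > 0} = (\<integral>\<^sup>+x. indicator {x \<in> space Q. X k x > 0} x \<partial>Q)"
      by simp
    also have "\<dots> = (\<integral>\<^sup>+x. ennreal (X k x powr 0) \<partial>Q)"
      using nonneg by (intro nn_integral_cong) (auto simp: indicator_def less_le)
    also have "\<dots> = 1"
      using moment[of 0 k] \<delta>_pos by (simp add: g_0)
    finally show "AE x in Q. X k x > 0"
      by (subst Q.AE_iff_emeasure_eq_1) auto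
  qed
  have "AE x in Q. \<forall>n. \<forall>\<^sub>F k in sequentially. \<bar>ln (X k x) / real k - \<gamma>\<bar> < inverse (real (Suc n))"
    unfolding AE_all_countable
    using AE_eventually_ln_div_near[OF assms(1,2) X_pos eq_refl[OF moment]] by simp
  then show "AE x in Q. (\<lambda>k. ln (X k x) / real k) \<longlonglongrightarrow> \<gamma>"
  proof eventually_elim
    case (elim x)
    show ?case
    proof (rule tendstoI)
      fix e :: real assume "e > 0"
      then obtain n where n_large: "inverse (real (Suc n)) < e" using reals_Archimedean by auto
      show "\<forall>\<^sub>F k in sequentially. dist (ln (X k x) / real k) \<gamma> < e"
        using elim[THEN spec, of n] n_large by (auto simp: dist_real_def elim: eventually_mono)
    qed
  qed
qed

end

section \<open>Spectral norm and largest eigenvalue\<close>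

abbreviation coord_norm :: "nat \<Rightarrow> (nat \<Rightarrow> real) \<Rightarrow> real" where
  "coord_norm d u \<equiv> L2_set u {..<d}"

definition coord_sphere :: "nat \<Rightarrow> (nat \<Rightarrow> real) set" where
  "coord_sphere d = {u. coord_norm d u = 1 \<and> (\<forall>j\<ge>d. u j = 0)}"

abbreviation gram :: "real mat \<Rightarrow> real mat" where
  "gram A \<equiv> transpose_mat A * A"

lemma vnorm_eq_coord_norm: "vnorm x = coord_norm (dim_vec x) (\<lambda>i. x $ i)"
  by (simp add: vnorm_def L2_set_def scalar_prod_def power2_eq_square lessThan_atLeast0)

lemma vnorm_nonneg [simp]: "vnorm x \<ge> 0"
  by (simp add: vnorm_eq_coord_norm)

lemma vnorm_power2: "(vnorm x)\<^sup>2 = x \<bullet> x"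
  by (simp add: vnorm_def scalar_prod_def sum_nonneg)

lemma vnorm_vec [simp]: "vnorm (vec d u) = coord_norm d u"
  unfolding vnorm_eq_coord_norm by (intro L2_set_cong) auto

lemma vnorm_smult: "vnorm (t \<cdot>\<^sub>v x) = \<bar>t\<bar> * vnorm x"
  unfolding vnorm_eq_coord_norm L2_set_cmult[symmetric] by (intro L2_set_cong) auto

lemma vnorm_eq_0_iff: "x \<in> carrier_vec d \<Longrightarrow> vnorm x = 0 \<longleftrightarrow> x = 0\<^sub>v d"
  by (auto simp: vnorm_eq_coord_norm L2_set_eq_0_iff intro!: eq_vecI)

lemma vnorm_unit_vec: "j < d \<Longrightarrow> vnorm (unit_vec d j) = 1"
  by (simp add: vnorm_def)

lemma vnorm_mult_vec:
  assumes "A \<in> carrier_mat n d"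
  shows "vnorm (A *\<^sub>v vec d u) = coord_norm n (\<lambda>i. \<Sum>j<d. A $$ (i, j) * u j)"
  using assms
  by (auto simp: vnorm_eq_coord_norm scalar_prod_def lessThan_atLeast0 intro!: L2_set_cong sum.cong)

lemma vnorm_mult_vec_le:
  assumes A_carrier: "A \<in> carrier_mat n d" and x_carrier: "x \<in> carrier_vec d"
  shows "vnorm (A *\<^sub>v x) \<le> (\<Sum>j<d. vnorm (A *\<^sub>v unit_vec d j)) * vnorm x"
proof -
  have column: "vnorm (A *\<^sub>v unit_vec d j) = coord_norm n (\<lambda>i. A $$ (i, j))" if "j < d" for j
    using A_carrier that by (auto simp: vnorm_eq_coord_norm intro!: L2_set_cong)
  have "vec d (\<lambda>j. x $ j) = x"
    using x_carrier by auto
  then have "vnorm (A *\<^sub>v x) = coord_norm n (\<lambda>i. \<Sum>j<d. x $ j * A $$ (i, j))"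
    using vnorm_mult_vec[OF A_carrier, of "\<lambda>j. x $ j"] by (simp add: mult.commute)
  also have "\<dots> \<le> (\<Sum>j<d. coord_norm n (\<lambda>i. x $ j * A $$ (i, j)))"
    by (rule L2_set_sum_le)
  also have "\<dots> = (\<Sum>j<d. \<bar>x $ j\<bar> * vnorm (A *\<^sub>v unit_vec d j))"
    by (simp add: L2_set_cmult column)
  also have "\<dots> \<le> (\<Sum>j<d. vnorm x * vnorm (A *\<^sub>v unit_vec d j))"
    using x_carrier
    by (intro sum_mono mult_right_mono) (auto simp: vnorm_eq_coord_norm intro!: abs_le_L2_set)
  finally show ?thesis by (simp add: sum_distrib_left mult.commute)
qed

lemma bdd_above_spec_norm:
  assumes "A \<in> carrier_mat n d"
  shows "bdd_above {vnorm (A *\<^sub>v x) | x. x \<in> carrier_vec d \<and> vnorm x = 1}"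
  using vnorm_mult_vec_le[OF assms]
  by (intro bdd_aboveI[of _ "\<Sum>j<d. vnorm (A *\<^sub>v unit_vec d j)"]) force

lemma spec_norm_set_nonempty:
  assumes "d \<ge> 1"
  shows "{vnorm (A *\<^sub>v x) | x. x \<in> carrier_vec d \<and> vnorm x = 1} \<noteq> {}"
  using assms vnorm_unit_vec[of 0 d] unit_vec_carrier[of d 0] by fastforce

lemma less_spec_norm_iff:
  assumes "A \<in> carrier_mat n d" "d \<ge> 1"
  shows "c < spec_norm d A \<longleftrightarrow> (\<exists>x\<in>carrier_vec d. vnorm x = 1 \<and> c < vnorm (A *\<^sub>v x))"
  unfolding spec_norm_def
  by (subst less_cSup_iff[OF spec_norm_set_nonempty bdd_above_spec_norm]) (use assms in auto)

lemma vnorm_le_spec_norm: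
  assumes A_carrier: "A \<in> carrier_mat n d" and x_unit: "x \<in> carrier_vec d" "vnorm x = 1"
  shows "vnorm (A *\<^sub>v x) \<le> spec_norm d A"
  unfolding spec_norm_def using x_unit by (intro cSup_upper bdd_above_spec_norm[OF A_carrier]) auto

lemma spec_norm_nonneg:
  assumes "A \<in> carrier_mat n d" "d \<ge> 1"
  shows "spec_norm d A \<ge> 0"
  using vnorm_le_spec_norm[OF assms(1), of "unit_vec d 0"] assms(2)
    order_trans[OF vnorm_nonneg] by (simp add: vnorm_unit_vec)

lemma vnorm_mult_vec_le_spec_norm:
  assumes A_carrier: "A \<in> carrier_mat n d" and x_carrier: "x \<in> carrier_vec d"
  shows "vnorm (A *\<^sub>v x) \<le> spec_norm d A * vnorm x"
proof (cases "vnorm x = 0")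
  case True
  then show ?thesis using vnorm_mult_vec_le[OF A_carrier x_carrier] by simp
next
  case False
  then have vnorm_pos: "vnorm x > 0" using vnorm_nonneg[of x] by linarith
  have "vnorm (A *\<^sub>v ((1 / vnorm x) \<cdot>\<^sub>v x)) \<le> spec_norm d A"
    using x_carrier vnorm_pos by (intro vnorm_le_spec_norm[OF A_carrier]) (simp_all add: vnorm_smult)
  then show ?thesis
    using A_carrier x_carrier vnorm_pos by (simp add: mult_mat_vec vnorm_smult pos_divide_le_eq)
qed

lemma spec_norm_le_sum_columns:
  assumes "A \<in> carrier_mat n d" "d \<ge> 1"
  shows "spec_norm d A \<le> (\<Sum>j<d. vnorm (A *\<^sub>v unit_vec d j))"
  unfolding spec_norm_def
  using spec_norm_set_nonempty[OF assms(2)] vnorm_mult_vec_le[OF assms(1)]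
  by (intro cSup_least) force+

lemma compact_coord_sphere: "compact (coord_sphere d)"
proof -
  define B where "B j = (if j < d then {-1..1} else {0 :: real})" for j
  have "compactin (product_topology (\<lambda>_. euclidean) UNIV) (Pi\<^sub>E UNIV B)"
    unfolding compactin_PiE by (simp add: B_def)
  then have "compact (Pi\<^sub>E UNIV B)"
    by (simp add: euclidean_product_topology)
  moreover have "closed {u :: nat \<Rightarrow> real. coord_norm d u = 1}"
    unfolding L2_set_def by (intro closed_Collect_eq continuous_intros) auto
  ultimately have "compact (Pi\<^sub>E UNIV B \<inter> {u. coord_norm d u = 1})"
    by (rule compact_Int_closed)
  also have "Pi\<^sub>E UNIV B \<inter> {u. coord_norm d u = 1} = coord_sphere d"
  proof -
    have "u j \<in> {-1..1}" if "coord_norm d u = 1" "j < d" for u j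
      using abs_le_L2_set[of "{..<d}" j u] that by auto
    then show ?thesis
      unfolding coord_sphere_def by (fastforce simp: B_def PiE_iff split: if_splits)
  qed
  finally show ?thesis .
qed

lemma spec_norm_attained:
  assumes A_carrier: "A \<in> carrier_mat n d" and d_pos: "d \<ge> 1"
  obtains x where "x \<in> carrier_vec d" "vnorm x = 1" "vnorm (A *\<^sub>v x) = spec_norm d A"
proof -
  have "indicator {0} \<in> coord_sphere d"
    using d_pos by (auto simp: coord_sphere_def)
  moreover have "continuous_on (coord_sphere d) (\<lambda>u. vnorm (A *\<^sub>v vec d u))"
    unfolding vnorm_mult_vec[OF A_carrier] L2_set_def
    by (intro continuous_intros continuous_on_subset[OF continuous_on_product_coordinates]) auto
  ultimately obtain u where u_sphere: "u \<in> coord_sphere d"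
    and u_maximal: "\<And>w. w \<in> coord_sphere d \<Longrightarrow> vnorm (A *\<^sub>v vec d w) \<le> vnorm (A *\<^sub>v vec d u)"
    using continuous_attains_sup[of "coord_sphere d" "\<lambda>u. vnorm (A *\<^sub>v vec d u)"] compact_coord_sphere
    by (auto simp: coord_sphere_def)
  have "vnorm (A *\<^sub>v x) \<le> vnorm (A *\<^sub>v vec d u)" if x_unit: "x \<in> carrier_vec d" "vnorm x = 1" for x
  proof -
    have "vec d (\<lambda>j. if j < d then x $ j else 0) = x"
      using x_unit by auto
    moreover from this have "(\<lambda>j. if j < d then x $ j else 0) \<in> coord_sphere d"
      using x_unit vnorm_vec[of d "\<lambda>j. if j < d then x $ j else 0"] by (simp add: coord_sphere_def)
    ultimately show ?thesis
      using u_maximal by metis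
  qed
  then have "\<not> vnorm (A *\<^sub>v vec d u) < spec_norm d A"
    by (auto simp: less_spec_norm_iff[OF A_carrier d_pos] not_less)
  then show ?thesis
    using u_sphere vnorm_le_spec_norm[OF A_carrier, of "vec d u"]
    by (intro that[of "vec d u"]) (auto simp: coord_sphere_def)
qed

lemma scalar_prod_gram:
  fixes A :: "real mat"
  assumes A_carrier: "A \<in> carrier_mat n d" and x_carrier: "x \<in> carrier_vec d"
    and y_carrier: "y \<in> carrier_vec d"
  shows "(gram A *\<^sub>v x) \<bullet> y = (A *\<^sub>v x) \<bullet> (A *\<^sub>v y)"
  using transpose_vec_mult_scalar[OF A_carrier y_carrier, of "A *\<^sub>v x"] A_carrier x_carrier
  by (simp add: assoc_mult_mat_vec[of "transpose_mat A" d n A d x])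

lemma vnorm_add_smult_power2:
  assumes "x \<in> carrier_vec d" "z \<in> carrier_vec d"
  shows "(vnorm (x + t \<cdot>\<^sub>v z))\<^sup>2 = (vnorm x)\<^sup>2 + 2 * t * (x \<bullet> z) + t\<^sup>2 * (vnorm z)\<^sup>2"
  using assms comm_scalar_prod[of z d x]
  unfolding vnorm_power2
  by (simp add: add_scalar_prod_distrib[of _ d] scalar_prod_add_distrib[of _ d] power2_eq_square
      algebra_simps)

lemma le_0_if_linear_le_quadratic:
  fixes b c :: real
  assumes "\<And>t. t > 0 \<Longrightarrow> t * b \<le> t\<^sup>2 * c"
  shows "b \<le> 0"
proof (rule ccontr)
  assume "\<not> b \<le> 0"
  then have b_pos: "b > 0" by simp
  then have "c > 0" using assms[of 1] by simp
  then show False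
    using assms[of "b / (2 * c)"] b_pos by (simp add: field_simps power2_eq_square)
qed

text \<open>Such an x minimises the nonnegative quadratic form q below, so the derivative of q at x
  vanishes in every direction, in particular in the direction of the residual z.\<close>

lemma gram_mult_vec_maximizer:
  assumes A_carrier: "A \<in> carrier_mat n d" and x_carrier: "x \<in> carrier_vec d"
    and maximal: "vnorm (A *\<^sub>v x) = spec_norm d A * vnorm x"
  shows "gram A *\<^sub>v x = (spec_norm d A)\<^sup>2 \<cdot>\<^sub>v x"
proof -
  define S where "S = gram A"
  define \<sigma> where "\<sigma> = spec_norm d A"
  define q where "q y = \<sigma>\<^sup>2 * (vnorm y)\<^sup>2 - (vnorm (A *\<^sub>v y))\<^sup>2" for y
  define z where "z = S *\<^sub>v x - \<sigma>\<^sup>2 \<cdot>\<^sub>v x"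
  have S_carrier: "S \<in> carrier_mat d d" using A_carrier by (simp add: S_def)
  have z_carrier: "z \<in> carrier_vec d" using S_carrier x_carrier by (simp add: z_def)
  have q_nonneg: "q y \<ge> 0" if "y \<in> carrier_vec d" for y
    using power_mono[OF vnorm_mult_vec_le_spec_norm[OF A_carrier that], of 2]
    by (simp add: q_def \<sigma>_def power_mult_distrib)
  have z_power2: "(vnorm z)\<^sup>2 = (A *\<^sub>v x) \<bullet> (A *\<^sub>v z) - \<sigma>\<^sup>2 * (x \<bullet> z)"
    unfolding vnorm_power2 scalar_prod_gram[OF A_carrier x_carrier z_carrier, symmetric] S_def[symmetric]
    using S_carrier x_carrier z_carrier
    by (subst (1) z_def, subst minus_scalar_prod_distrib[of _ d]) auto
  have "2 * (vnorm z)\<^sup>2 \<le> 0"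
  proof (rule le_0_if_linear_le_quadratic)
    fix t :: real
    have "A *\<^sub>v (x + t \<cdot>\<^sub>v z) = A *\<^sub>v x + t \<cdot>\<^sub>v (A *\<^sub>v z)"
      using A_carrier x_carrier z_carrier by (simp add: mult_add_distrib_mat_vec mult_mat_vec)
    then have "q (x + t \<cdot>\<^sub>v z) = q x - 2 * t * ((A *\<^sub>v x) \<bullet> (A *\<^sub>v z) - \<sigma>\<^sup>2 * (x \<bullet> z)) + t\<^sup>2 * q z"
      using A_carrier x_carrier z_carrier vnorm_add_smult_power2[of x d z t]
        vnorm_add_smult_power2[of "A *\<^sub>v x" n "A *\<^sub>v z" t]
      by (simp add: q_def algebra_simps)
    also have "\<dots> = t\<^sup>2 * q z - t * (2 * (vnorm z)\<^sup>2)"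
      by (simp add: z_power2) (simp add: q_def maximal \<sigma>_def power_mult_distrib)
    finally show "t * (2 * (vnorm z)\<^sup>2) \<le> t\<^sup>2 * q z"
      using q_nonneg[of "x + t \<cdot>\<^sub>v z"] x_carrier z_carrier by simp
  qed
  then have "z = 0\<^sub>v d"
    using vnorm_eq_0_iff[OF z_carrier] by simp
  moreover have "S *\<^sub>v x = z + \<sigma>\<^sup>2 \<cdot>\<^sub>v x"
    using S_carrier x_carrier by (auto simp: z_def)
  ultimately show ?thesis
    using x_carrier by (simp add: S_def \<sigma>_def)
qed

lemma eigenvalue_gram_spec_norm:
  assumes A_carrier: "A \<in> carrier_mat n d" and d_pos: "d \<ge> 1"
  shows "eigenvalue (gram A) ((spec_norm d A)\<^sup>2)"
proof -
  obtain x where x_maximal: "x \<in> carrier_vec d" "vnorm x = 1" "vnorm (A *\<^sub>v x) = spec_norm d A"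
    using spec_norm_attained[OF A_carrier d_pos] by blast
  moreover from this have "x \<noteq> 0\<^sub>v d"
    using vnorm_eq_0_iff[OF x_maximal(1)] by simp
  ultimately show ?thesis
    using gram_mult_vec_maximizer[OF A_carrier x_maximal(1)] A_carrier
    unfolding eigenvalue_def eigenvector_def by (intro exI[of _ x]) simp
qed

lemma lambda_max_gram:
  assumes A_carrier: "A \<in> carrier_mat n d" and d_pos: "d \<ge> 1"
  shows "lambda_max (gram A) = (spec_norm d A)\<^sup>2"
  unfolding lambda_max_def
proof (rule Max_eqI)
  let ?S = "gram A"
  have gram_carrier: "?S \<in> carrier_mat d d" using A_carrier by simp
  have "char_poly ?S \<noteq> 0"
    using degree_monic_char_poly[OF gram_carrier] d_pos by auto
  then show "finite {l. eigenvalue ?S l}"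
    using poly_roots_finite[of "char_poly ?S"] by (simp add: eigenvalue_root_char_poly[OF gram_carrier])
  show "(spec_norm d A)\<^sup>2 \<in> {l. eigenvalue ?S l}"
    using eigenvalue_gram_spec_norm[OF assms] by simp
  fix l assume "l \<in> {l. eigenvalue ?S l}"
  then obtain x where x_eigenvector: "x \<in> carrier_vec d" "x \<noteq> 0\<^sub>v d" "?S *\<^sub>v x = l \<cdot>\<^sub>v x"
    using gram_carrier by (auto simp: eigenvalue_def eigenvector_def)
  have "l * (vnorm x)\<^sup>2 = (vnorm (A *\<^sub>v x))\<^sup>2"
    using scalar_prod_gram[OF A_carrier x_eigenvector(1) x_eigenvector(1)] x_eigenvector
    by (simp add: vnorm_power2)
  also have "\<dots> \<le> (spec_norm d A)\<^sup>2 * (vnorm x)\<^sup>2"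
    using power_mono[OF vnorm_mult_vec_le_spec_norm[OF A_carrier x_eigenvector(1)], of 2]
    by (simp add: power_mult_distrib)
  finally have "l * (vnorm x)\<^sup>2 \<le> (spec_norm d A)\<^sup>2 * (vnorm x)\<^sup>2" .
  moreover have "(vnorm x)\<^sup>2 > 0"
    using vnorm_eq_0_iff[OF x_eigenvector(1)] x_eigenvector(2) by auto
  ultimately show "l \<le> (spec_norm d A)\<^sup>2"
    by (rule mult_right_le_imp_le)
qed

section \<open>One step of stochastic gradient descent\<close>

text \<open>Vectors are functions of which only the values below d matter: unlike real vec, their type carries
  a topology and a Borel algebra. In the sequel kappa is eta / b, and I is the index set of a batch.\<close>

definition sgd_step :: "real \<Rightarrow> nat set \<Rightarrow> nat \<Rightarrow> (nat \<times> nat \<Rightarrow> real) \<Rightarrow> (nat \<Rightarrow> real) \<Rightarrow> nat \<Rightarrow> real" where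
  "sgd_step \<kappa> I d w u = (\<lambda>p. u p - \<kappa> * (\<Sum>i\<in>I. w (i, p) * (\<Sum>q<d. w (i, q) * u q)))"

fun sgd_iter :: "real \<Rightarrow> nat \<Rightarrow> nat \<Rightarrow> (nat \<times> nat \<Rightarrow> real) \<Rightarrow> nat \<Rightarrow> (nat \<Rightarrow> real) \<Rightarrow> nat \<Rightarrow> real" where
  "sgd_iter \<kappa> b d w 0 u = u"
| "sgd_iter \<kappa> b d w (Suc k) u = sgd_step \<kappa> {b * k + 1 .. b * Suc k} d w (sgd_iter \<kappa> b d w k u)"

definition first_column :: "real \<Rightarrow> nat set \<Rightarrow> (nat \<times> nat \<Rightarrow> real) \<Rightarrow> nat \<Rightarrow> real" where
  "first_column \<kappa> I w = (\<lambda>p. indicator {0} p - \<kappa> * (\<Sum>i\<in>I. w (i, p) * w (i, 0)))"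

definition gain :: "real \<Rightarrow> nat set \<Rightarrow> nat \<Rightarrow> (nat \<times> nat \<Rightarrow> real) \<Rightarrow> real" where
  "gain \<kappa> I d w = coord_norm d (first_column \<kappa> I w)"

definition rotate_rows ::
  "real \<Rightarrow> real \<Rightarrow> nat \<Rightarrow> nat \<Rightarrow> nat set \<Rightarrow> (nat \<times> nat \<Rightarrow> real) \<Rightarrow> nat \<times> nat \<Rightarrow> real" where
  "rotate_rows c s p q I w
      = (\<lambda>(i, r). if i \<in> I then plane_rotation c s p q (\<lambda>r. w (i, r)) r else w (i, r))"

lemma gain_nonneg [simp]: "gain \<kappa> I d w \<ge> 0"
  by (simp add: gain_def)

lemma first_column_0: "first_column \<kappa> I w 0 = 1 - \<kappa> * (\<Sum>i\<in>I. (w (i, 0))\<^sup>2)"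
  by (simp add: first_column_def power2_eq_square)

lemma sgd_step_cong:
  assumes "\<And>r. r < d \<Longrightarrow> u r = u' r" "r < d" "\<And>i r. i \<in> I \<Longrightarrow> r < d \<Longrightarrow> w (i, r) = w' (i, r)"
  shows "sgd_step \<kappa> I d w u r = sgd_step \<kappa> I d w' u' r"
  using assms by (simp add: sgd_step_def)

lemma sgd_iter_cong:
  assumes "r < d" "\<And>i r. i \<le> b * k \<Longrightarrow> r < d \<Longrightarrow> w (i, r) = w' (i, r)"
  shows "sgd_iter \<kappa> b d w k u r = sgd_iter \<kappa> b d w' k u r"
  using assms
proof (induction k arbitrary: r)
  case (Suc k)
  have "b * k \<le> b * Suc k" by simp
  then show ?case
    using Suc.prems unfolding sgd_iter.simps
    by (intro sgd_step_cong Suc.IH) (auto intro: order_trans)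
qed simp

lemma sgd_step_cmult: "sgd_step \<kappa> I d w (\<lambda>r. t * u r) = (\<lambda>r. t * sgd_step \<kappa> I d w u r)"
  by (rule ext) (simp add: sgd_step_def algebra_simps sum_distrib_left)

lemma sgd_step_axis:
  assumes "d \<ge> 1"
  shows "sgd_step \<kappa> I d w (indicator {0}) = first_column \<kappa> I w"
proof -
  have "w (i, q) * indicator {0} q = (if q = 0 then w (i, 0) else 0)" for i q
    by simp
  then show ?thesis
    using assms by (simp add: sgd_step_def first_column_def)
qed

lemma coord_norm_sgd_step_axis:
  assumes d_pos: "d \<ge> 1" and axis: "\<And>r. 1 \<le> r \<Longrightarrow> r < d \<Longrightarrow> u r = 0"
  shows "coord_norm d (sgd_step \<kappa> I d w u) = coord_norm d u * gain \<kappa> I d w"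
proof -
  have u_eq: "u r = u 0 * indicator {0} r" if "r < d" for r
    using axis[of r] that by (cases "r = 0") auto
  have "coord_norm d u = coord_norm d (\<lambda>r. u 0 * indicator {0} r)"
    by (intro L2_set_cong refl u_eq) simp
  also have "\<dots> = \<bar>u 0\<bar>"
    using d_pos by (simp only: L2_set_cmult) simp
  finally have norm_u: "coord_norm d u = \<bar>u 0\<bar>" .
  have "coord_norm d (sgd_step \<kappa> I d w u) = coord_norm d (sgd_step \<kappa> I d w (\<lambda>r. u 0 * indicator {0} r))"
    by (intro L2_set_cong sgd_step_cong refl u_eq) auto
  also have "\<dots> = \<bar>u 0\<bar> * gain \<kappa> I d w"
    by (simp only: sgd_step_cmult L2_set_cmult sgd_step_axis[OF d_pos] gain_def)
  finally show ?thesis by (simp only: norm_u)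
qed

lemma continuous_on_sgd_step [continuous_intros]:
  assumes "\<And>r. continuous_on UNIV (\<lambda>w. u w r)"
  shows "continuous_on UNIV (\<lambda>w. sgd_step \<kappa> I d w (u w) r)"
  unfolding sgd_step_def by (intro continuous_intros assms continuous_on_product_coordinates)

lemma continuous_on_sgd_iter [continuous_intros]:
  "continuous_on UNIV (\<lambda>w. sgd_iter \<kappa> b d w k u r)"
  by (induction k arbitrary: r) (simp, unfold sgd_iter.simps, intro continuous_on_sgd_step)

lemma continuous_on_first_column [continuous_intros]:
  "continuous_on UNIV (\<lambda>w. first_column \<kappa> I w r)"
  unfolding first_column_def by (intro continuous_intros continuous_on_product_coordinates)

lemma continuous_on_gain [continuous_intros]: "continuous_on UNIV (gain \<kappa> I d)"
  unfolding gain_def by (intro continuous_intros)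

lemma sum_plane_rotation_mult:
  fixes u x :: "'i \<Rightarrow> real"
  assumes coords: "finite A" "p \<in> A" "q \<in> A" "p \<noteq> q" and cos_sin: "c\<^sup>2 + s\<^sup>2 = 1"
  shows "(\<Sum>r\<in>A. plane_rotation c s p q u r * plane_rotation c s p q x r) = (\<Sum>r\<in>A. u r * x r)"
proof -
  have split: "(\<Sum>r\<in>A. f r) = f p + f q + (\<Sum>r\<in>A - {p} - {q}. f r)" for f :: "'i \<Rightarrow> real"
    using coords by (simp add: sum.remove[of A p] sum.remove[of "A - {p}" q])
  have "(c * u p - s * u q) * (c * x p - s * x q) + (s * u p + c * u q) * (s * x p + c * x q)
      = (c\<^sup>2 + s\<^sup>2) * (u p * x p + u q * x q)"
    by (simp add: power2_eq_square algebra_simps)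
  moreover have "(\<Sum>r\<in>A - {p} - {q}. plane_rotation c s p q u r * plane_rotation c s p q x r)
      = (\<Sum>r\<in>A - {p} - {q}. u r * x r)"
    by (intro sum.cong) (auto simp: plane_rotation_def)
  ultimately show ?thesis
    unfolding split using coords(4) cos_sin by (simp add: plane_rotation_def)
qed

lemma L2_set_plane_rotation:
  assumes "finite A" "p \<in> A" "q \<in> A" "p \<noteq> q" "c\<^sup>2 + s\<^sup>2 = 1"
  shows "L2_set (plane_rotation c s p q u) A = L2_set u A"
  using sum_plane_rotation_mult[OF assms, of u u] by (simp add: L2_set_def power2_eq_square)

lemma sgd_step_rotate:
  assumes "p \<noteq> q" "p < d" "q < d" and "c\<^sup>2 + s\<^sup>2 = 1"
  shows "sgd_step \<kappa> I d (rotate_rows c s p q I w) (plane_rotation c s p q u)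
    = plane_rotation c s p q (sgd_step \<kappa> I d w u)"
proof
  fix r
  let ?rot = "plane_rotation c s p q" and ?y = "\<lambda>i. \<Sum>r<d. w (i, r) * u r"
  have "(\<Sum>r<d. rotate_rows c s p q I w (i, r) * ?rot u r) = ?y i" if "i \<in> I" for i
    using sum_plane_rotation_mult[of "{..<d}" p q c s "\<lambda>r. w (i, r)" u] assms that
    by (simp add: rotate_rows_def)
  then have "sgd_step \<kappa> I d (rotate_rows c s p q I w) (?rot u) r
      = ?rot u r - \<kappa> * (\<Sum>i\<in>I. ?rot (\<lambda>r. w (i, r)) r * ?y i)"
    by (simp add: sgd_step_def rotate_rows_def)
  also have "\<dots> = ?rot (sgd_step \<kappa> I d w u) r"
    by (simp add: plane_rotation_def sgd_step_def algebra_simps sum.distrib sum_subtractf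
        sum_distrib_left)
  finally show "sgd_step \<kappa> I d (rotate_rows c s p q I w) (?rot u) r = ?rot (sgd_step \<kappa> I d w u) r" .
qed

lemma rotate_rows_insert:
  assumes "i \<notin> I" "p \<noteq> q"
  shows "rotate_rows c s p q (insert i I) w = plane_rotation c s (i, p) (i, q) (rotate_rows c s p q I w)"
  using assms by (auto simp: rotate_rows_def plane_rotation_def fun_eq_iff)

lemma ex_rotation_annihilating:
  fixes x y :: real
  assumes "y \<noteq> 0"
  obtains c s where "c\<^sup>2 + s\<^sup>2 = 1" "s \<noteq> 0" "s * x + c * y = 0"
proof
  let ?r = "sqrt (x\<^sup>2 + y\<^sup>2)"
  have "x\<^sup>2 + y\<^sup>2 > 0" using assms by (simp add: add_nonneg_pos)
  then have "?r > 0" "?r\<^sup>2 = x\<^sup>2 + y\<^sup>2" by simp_all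
  then show "(x / ?r)\<^sup>2 + (- y / ?r)\<^sup>2 = 1" "- y / ?r \<noteq> 0" "- y / ?r * x + x / ?r * y = 0"
    using assms by (simp_all add: power_divide flip: add_divide_distrib)
qed

context gaussian_data
begin

lemma measurable_gain [measurable]: "gain \<kappa> I d \<in> borel_measurable P"
  by (intro continuous_imp_measurable_P continuous_intros)

lemma measurable_coord_norm_sgd_step [measurable]:
  "(\<lambda>w. coord_norm d (sgd_step \<kappa> I d w u)) \<in> borel_measurable P"
  by (intro continuous_imp_measurable_P continuous_intros)

lemma measurable_coord_norm_sgd_iter [measurable]:
  "(\<lambda>w. coord_norm d (sgd_iter \<kappa> b d w k u)) \<in> borel_measurable P"
  by (intro continuous_imp_measurable_P continuous_intros)

lemma nn_integral_rotate_rows: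
  assumes "finite I" "f \<in> borel_measurable P" and p_neq_q: "p \<noteq> q" and cos_sin: "c\<^sup>2 + s\<^sup>2 = 1" "s \<noteq> 0"
  shows "(\<integral>\<^sup>+w. f (rotate_rows c s p q I w) \<partial>P) = (\<integral>\<^sup>+w. f w \<partial>P)"
  using assms(1,2)
proof (induction I arbitrary: f)
  case empty
  then show ?case by (simp add: rotate_rows_def)
next
  case (insert i I)
  note [measurable] = insert.prems
  have "(\<integral>\<^sup>+w. f (rotate_rows c s p q (insert i I) w) \<partial>P)
      = (\<integral>\<^sup>+w. f (plane_rotation c s (i, p) (i, q) w) \<partial>P)"
    unfolding rotate_rows_insert[OF insert.hyps(2) p_neq_q] by (rule insert.IH) measurable
  also have "\<dots> = (\<integral>\<^sup>+w. f w \<partial>P)"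
    using insert.prems p_neq_q cos_sin by (intro nn_integral_plane_rotation) auto
  finally show ?case .
qed

lemma nn_integral_sgd_step_rotate:
  assumes I_finite: "finite I" and [measurable]: "f \<in> borel_measurable borel"
    and axes: "p \<noteq> q" "p < d" "q < d" and cos_sin: "c\<^sup>2 + s\<^sup>2 = 1" "s \<noteq> 0"
  shows "(\<integral>\<^sup>+w. f (coord_norm d (sgd_step \<kappa> I d w (plane_rotation c s p q u))) \<partial>P)
    = (\<integral>\<^sup>+w. f (coord_norm d (sgd_step \<kappa> I d w u)) \<partial>P)"
proof -
  have "(\<integral>\<^sup>+w. f (coord_norm d (sgd_step \<kappa> I d w (plane_rotation c s p q u))) \<partial>P)
      = (\<integral>\<^sup>+w. f (coord_norm d (sgd_step \<kappa> I d (rotate_rows c s p q I w) (plane_rotation c s p q u))) \<partial>P)"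
    by (rule nn_integral_rotate_rows[OF I_finite _ axes(1) cos_sin, symmetric]) measurable
  also have "\<dots> = (\<integral>\<^sup>+w. f (coord_norm d (sgd_step \<kappa> I d w u)) \<partial>P)"
    unfolding sgd_step_rotate[OF axes cos_sin(1)] using axes cos_sin(1)
    by (simp add: L2_set_plane_rotation)
  finally show ?thesis .
qed

text \<open>Rotating the last nonzero coordinate of u into the coordinate 0, again and again,
  moves u onto the first axis.\<close>

lemma nn_integral_sgd_step:
  assumes I_finite: "finite I" and d_pos: "d \<ge> 1" and f_measurable: "f \<in> borel_measurable borel"
  shows "(\<integral>\<^sup>+w. f (coord_norm d (sgd_step \<kappa> I d w u)) \<partial>P) = (\<integral>\<^sup>+w. f (coord_norm d u * gain \<kappa> I d w) \<partial>P)"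
proof -
  have "(\<integral>\<^sup>+w. f (coord_norm d (sgd_step \<kappa> I d w u)) \<partial>P) = (\<integral>\<^sup>+w. f (coord_norm d u * gain \<kappa> I d w) \<partial>P)"
    if "1 \<le> n" "\<And>r. n \<le> r \<Longrightarrow> r < d \<Longrightarrow> u r = 0" for n and u :: "nat \<Rightarrow> real"
    using that
  proof (induction n arbitrary: u rule: nat_induct_at_least)
    case base
    then show ?case using d_pos by (simp add: coord_norm_sgd_step_axis)
  next
    case (Suc n)
    show ?case
    proof (cases "n < d \<and> u n \<noteq> 0")
      case False
      then have "u r = 0" if "n \<le> r" "r < d" for r
        using that Suc.prems[of r] by (cases "r = n") auto
      then show ?thesis by (rule Suc.IH)
    next
      case True
      then obtain c s where cos_sin: "c\<^sup>2 + s\<^sup>2 = 1" "s \<noteq> 0" and zero: "s * u 0 + c * u n = 0"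
        using ex_rotation_annihilating by blast
      have axes: "0 \<noteq> n" "0 < d" "n < d" using True d_pos Suc.hyps by auto
      let ?u = "plane_rotation c s 0 n u"
      have "(\<integral>\<^sup>+w. f (coord_norm d (sgd_step \<kappa> I d w u)) \<partial>P)
          = (\<integral>\<^sup>+w. f (coord_norm d (sgd_step \<kappa> I d w ?u)) \<partial>P)"
        by (rule nn_integral_sgd_step_rotate[OF I_finite f_measurable axes cos_sin, symmetric])
      also have "\<dots> = (\<integral>\<^sup>+w. f (coord_norm d ?u * gain \<kappa> I d w) \<partial>P)"
        using zero axes Suc.prems by (intro Suc.IH) (auto simp: plane_rotation_def)
      finally show ?thesis
        using axes cos_sin(1) by (simp add: L2_set_plane_rotation)
    qed
  qed
  from this[of d u] show ?thesis using d_pos by simp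
qed

lemma nn_integral_sgd_step_powr:
  assumes "finite I" "d \<ge> 1"
  shows "(\<integral>\<^sup>+w. ennreal (coord_norm d (sgd_step \<kappa> I d w u) powr s) \<partial>P)
    = ennreal (coord_norm d u powr s) * (\<integral>\<^sup>+w. ennreal (gain \<kappa> I d w powr s) \<partial>P)"
proof -
  have "(\<integral>\<^sup>+w. ennreal (coord_norm d (sgd_step \<kappa> I d w u) powr s) \<partial>P)
      = (\<integral>\<^sup>+w. ennreal ((coord_norm d u * gain \<kappa> I d w) powr s) \<partial>P)"
    by (rule nn_integral_sgd_step[OF assms]) measurable
  also have "\<dots> = (\<integral>\<^sup>+w. ennreal (coord_norm d u powr s) * ennreal (gain \<kappa> I d w powr s) \<partial>P)"
    by (simp add: powr_mult ennreal_mult')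
  also have "\<dots> = ennreal (coord_norm d u powr s) * (\<integral>\<^sup>+w. ennreal (gain \<kappa> I d w powr s) \<partial>P)"
    by (rule nn_integral_cmult) measurable
  finally show ?thesis .
qed

lemma nn_integral_P_reindex:
  assumes f_measurable: "f \<in> borel_measurable P" and "inj \<pi>"
  shows "(\<integral>\<^sup>+w. f (\<lambda>j. w (\<pi> j)) \<partial>P) = (\<integral>\<^sup>+w. f w \<partial>P)"
proof -
  have "distr P P (\<lambda>w j. w (\<pi> j)) = P"
    using distr_PiM_reindex[of UNIV "\<lambda>_. N" \<pi> UNIV] assms(2) N.prob_space_axioms
    by (simp add: restrict_def)
  moreover have "(\<lambda>w j. w (\<pi> j)) \<in> P \<rightarrow>\<^sub>M P"
    using measurable_restrict[of UNIV "\<lambda>j w. w (\<pi> j)" P "\<lambda>_. N"] by (simp add: restrict_def)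
  ultimately show ?thesis
    using nn_integral_distr[of "\<lambda>w j. w (\<pi> j)" P P f] f_measurable by simp
qed

lemma nn_integral_gain_reindex:
  assumes [measurable]: "f \<in> borel_measurable borel" and \<pi>_inj: "inj \<pi>"
  shows "(\<integral>\<^sup>+w. f (gain \<kappa> (\<pi> ` I) d w) \<partial>P) = (\<integral>\<^sup>+w. f (gain \<kappa> I d w) \<partial>P)"
proof -
  let ?\<pi> = "map_prod \<pi> id"
  have "gain \<kappa> (\<pi> ` I) d w = gain \<kappa> I d (\<lambda>j. w (?\<pi> j))" for w
    using \<pi>_inj by (simp add: gain_def first_column_def sum.reindex inj_on_subset)
  then show ?thesis
    using nn_integral_P_reindex[of "\<lambda>w. f (gain \<kappa> I d w)" ?\<pi>] \<pi>_inj by (simp add: prod.inj_map)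
qed

text \<open>Negative s are allowed: a vanishing iterate contributes 0 powr s = 0 to both sides.\<close>

lemma nn_integral_sgd_iter_powr:
  assumes d_pos: "d \<ge> 1"
  shows "(\<integral>\<^sup>+w. ennreal (coord_norm d (sgd_iter \<kappa> b d w k u) powr s) \<partial>P)
    = ennreal (coord_norm d u powr s) * (\<integral>\<^sup>+w. ennreal (gain \<kappa> {1..b} d w powr s) \<partial>P) ^ k"
proof (induction k)
  case 0
  then show ?case by (simp add: data.P.emeasure_space_1[simplified])
next
  case (Suc k)
  define past :: "(nat \<times> nat) set" where "past = {..b * k} \<times> UNIV"
  let ?I = "{b * k + 1 .. b * Suc k}"
  let ?X = "\<lambda>k w. coord_norm d (sgd_iter \<kappa> b d w k u)"
  let ?m = "\<integral>\<^sup>+w. ennreal (gain \<kappa> {1..b} d w powr s) \<partial>P"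
  have "?I = (\<lambda>i. i + b * k) ` {1..b}"
    by (simp add: add.commute)
  then have batch: "(\<integral>\<^sup>+w. ennreal (gain \<kappa> ?I d w powr s) \<partial>P) = ?m"
    by (simp only:) (rule nn_integral_gain_reindex, auto)
  have merge: "?X (Suc k) (merge past (UNIV - past) (w, w'))
      = coord_norm d (sgd_step \<kappa> ?I d w' (sgd_iter \<kappa> b d w k u))"
    for w w'
    unfolding sgd_iter.simps
    by (intro L2_set_cong sgd_step_cong sgd_iter_cong) (auto simp: merge_def past_def)
  have "(\<integral>\<^sup>+w. ennreal (?X (Suc k) w powr s) \<partial>P)
      = (\<integral>\<^sup>+w. \<integral>\<^sup>+w'. ennreal (?X (Suc k) (merge past (UNIV - past) (w, w')) powr s) \<partial>P \<partial>P)"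
    by (rule data.nn_integral_PiM_merge) measurable
  also have "\<dots> = (\<integral>\<^sup>+w. ennreal (?X k w powr s) * ?m \<partial>P)"
    unfolding merge by (subst nn_integral_sgd_step_powr) (use d_pos batch in auto)
  also have "\<dots> = (\<integral>\<^sup>+w. ennreal (?X k w powr s) \<partial>P) * ?m"
    by (rule nn_integral_multc) measurable
  finally show ?case
    by (simp add: Suc.IH mult.left_commute mult.commute)
qed

end

section \<open>Moments of the gain\<close>

lemma abs_le_gain:
  assumes "d \<ge> 1"
  shows "\<bar>1 - \<kappa> * (\<Sum>i\<in>I. (w (i, 0))\<^sup>2)\<bar> \<le> gain \<kappa> I d w"
  using abs_le_L2_set[of "{..<d}" 0 "first_column \<kappa> I w"] assms
  by (simp add: gain_def first_column_0)

lemma gain_le: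
  assumes d_pos: "d \<ge> 1" and \<kappa>_nonneg: "\<kappa> \<ge> 0"
  shows "gain \<kappa> I d w \<le> 1 + \<kappa> * (\<Sum>j\<in>I \<times> {..<d}. (w j)\<^sup>2)"
proof -
  let ?a = "\<lambda>i. coord_norm d (\<lambda>p. w (i, p))"
  have "gain \<kappa> I d w = coord_norm d (\<lambda>p. indicator {0} p + (\<Sum>i\<in>I. (- \<kappa> * w (i, 0)) * w (i, p)))"
    by (simp add: gain_def first_column_def sum_distrib_left sum_negf mult_ac)
  also have "\<dots> \<le> coord_norm d (indicator {0}) + (\<Sum>i\<in>I. coord_norm d (\<lambda>p. (- \<kappa> * w (i, 0)) * w (i, p)))"
    by (intro order_trans[OF L2_set_triangle_ineq] add_left_mono L2_set_sum_le)
  also have "\<dots> = 1 + (\<Sum>i\<in>I. \<kappa> * (\<bar>w (i, 0)\<bar> * ?a i))"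
    using d_pos \<kappa>_nonneg unfolding L2_set_cmult by (simp add: abs_mult mult.assoc)
  also have "\<dots> \<le> 1 + (\<Sum>i\<in>I. \<kappa> * (?a i * ?a i))"
    using d_pos \<kappa>_nonneg abs_le_L2_set[of "{..<d}" 0]
    by (intro add_left_mono sum_mono mult_left_mono mult_right_mono) auto
  also have "\<dots> = 1 + \<kappa> * (\<Sum>i\<in>I. (?a i)\<^sup>2)"
    by (simp add: sum_distrib_left power2_eq_square)
  also have "\<dots> = 1 + \<kappa> * (\<Sum>j\<in>I \<times> {..<d}. (w j)\<^sup>2)"
    by (simp add: L2_set_power2 sum.cartesian_product case_prod_beta')
  finally show ?thesis .
qed

lemma affine_powr_le_exp:
  fixes \<kappa> \<delta> s :: real
  assumes "\<kappa> \<ge> 0" "\<delta> > 0" "s > 0"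
  obtains K where "K > 0" "\<And>x. x \<ge> 0 \<Longrightarrow> (1 + \<kappa> * x) powr s \<le> K * exp (\<delta> * x)"
proof -
  define m where "m = max 1 (\<kappa> * s / \<delta>)"
  have m_bounds: "m \<ge> 1" "\<kappa> \<le> m * (\<delta> / s)"
    using assms by (simp_all add: m_def max_def field_simps)
  have "(1 + \<kappa> * x) powr s \<le> m powr s * exp (\<delta> * x)" if x_nonneg: "x \<ge> 0" for x
  proof -
    have "\<kappa> * x \<le> m * (\<delta> / s) * x"
      using m_bounds(2) x_nonneg by (rule mult_right_mono)
    then have "1 + \<kappa> * x \<le> m * (1 + \<delta> * x / s)"
      using m_bounds(1) by (simp add: algebra_simps)
    also have "\<dots> \<le> m * exp (\<delta> * x / s)"
      using m_bounds(1) exp_ge_add_one_self[of "\<delta> * x / s"] by (intro mult_left_mono) simp_all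
    finally have "(1 + \<kappa> * x) powr s \<le> (m * exp (\<delta> * x / s)) powr s"
      using assms x_nonneg by (intro powr_mono2) simp_all
    also have "\<dots> = m powr s * exp (\<delta> * x)"
      using assms m_bounds by (simp add: powr_mult) (simp add: powr_def)
    finally show ?thesis .
  qed
  then show ?thesis using m_bounds(1) by (intro that[of "m powr s"]) simp_all
qed

lemma nn_integral_lborel_abs_powr_near_le:
  assumes "- 1 < a"
  shows "(\<integral>\<^sup>+x. ennreal (indicator {-1..1} (x - r) * \<bar>x - r\<bar> powr a) \<partial>lborel)
      \<le> 2 * ennreal (1 / (a + 1))"
proof -
  define f where "f y = ennreal (indicator {0..1} y * y powr a)" for y :: real
  have [measurable]: "f \<in> borel_measurable borel" unfolding f_def by measurable
  have "(\<integral>\<^sup>+y. f y \<partial>lborel) = ennreal (1 / (a + 1))"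
    using nn_integral_has_integral_lebesgue[OF _ has_integral_powr_from_0[of a 1]] assms
    by (simp add: f_def)
  then have "(\<integral>\<^sup>+x. f (x - r) + f (r - x) \<partial>lborel) = 2 * ennreal (1 / (a + 1))"
    using nn_integral_real_affine[of f 1 "- r"] nn_integral_real_affine[of f "-1" r]
    by (simp add: nn_integral_add mult_2)
  moreover have "ennreal (indicator {-1..1} (x - r) * \<bar>x - r\<bar> powr a) \<le> f (x - r) + f (r - x)" for x
    by (cases "x \<ge> r") (auto simp: f_def indicator_def)
  ultimately show ?thesis
    by (metis (no_types, lifting) nn_integral_mono)
qed

lemma abs_diff_square_powr_le:
  fixes D s x :: real
  assumes "s < 0" "x\<^sup>2 \<noteq> \<bar>D\<bar>"
  shows "\<bar>D - x\<^sup>2\<bar> powr s \<le> \<bar>x - sqrt \<bar>D\<bar>\<bar> powr (2 * s) + \<bar>x + sqrt \<bar>D\<bar>\<bar> powr (2 * s)"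
proof -
  define a b where "a = \<bar>x - sqrt \<bar>D\<bar>\<bar>" and "b = \<bar>x + sqrt \<bar>D\<bar>\<bar>"
  have "a * b = \<bar>x\<^sup>2 - \<bar>D\<bar>\<bar>"
    by (simp add: a_def b_def abs_mult[symmetric] square_diff_square_factored[symmetric]
        power2_eq_square)
      (simp add: algebra_simps)
  then have "0 < a * b" "a * b \<le> \<bar>D - x\<^sup>2\<bar>"
    using assms(2) zero_le_power2[of x] by linarith+
  then have "\<bar>D - x\<^sup>2\<bar> powr s \<le> (a * b) powr s"
    using assms(1) by (intro powr_mono2') auto
  also have "\<dots> = a powr s * b powr s"
    by (simp add: powr_mult a_def b_def)
  also have "\<dots> \<le> (a powr s)\<^sup>2 + (b powr s)\<^sup>2"
  proof -
    have "0 \<le> a powr s * b powr s" by simp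
    then show ?thesis using sum_squares_bound[of "a powr s" "b powr s"] by linarith
  qed
  also have "\<dots> = a powr (2 * s) + b powr (2 * s)"
    by (simp add: power2_eq_square powr_add[symmetric])
  finally show ?thesis by (simp add: a_def b_def)
qed

context gaussian_data
begin

lemma nn_integral_N_exp_square: "(\<integral>\<^sup>+x. ennreal (exp (x\<^sup>2 / (4 * v))) \<partial>N) = ennreal (sqrt 2)"
proof -
  interpret N2: prob_space "density lborel (normal_density 0 (sqrt (2 * v)))"
    using v_pos by (intro prob_space_normal_density) simp
  have "normal_density 0 (sqrt v) x * exp (x\<^sup>2 / (4 * v)) = sqrt 2 * normal_density 0 (sqrt (2 * v)) x"
    for x
  proof -
    have "exp (- (x\<^sup>2 / (2 * v))) * exp (x\<^sup>2 / (4 * v)) = exp (- (x\<^sup>2 / (4 * v)))"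
      unfolding mult_exp_exp using v_pos by (intro arg_cong[where f=exp]) (simp add: field_simps)
    then show ?thesis
      using v_pos by (simp add: normal_density_def real_sqrt_mult field_simps)
  qed
  then have "(\<integral>\<^sup>+x. ennreal (exp (x\<^sup>2 / (4 * v))) \<partial>N)
      = (\<integral>\<^sup>+x. ennreal (sqrt 2) * ennreal (normal_density 0 (sqrt (2 * v)) x) \<partial>lborel)"
    by (simp add: nn_integral_density ennreal_mult'[symmetric])
  also have "\<dots> = ennreal (sqrt 2)"
    using N2.emeasure_space_1 by (simp add: nn_integral_cmult emeasure_density)
  finally show ?thesis .
qed

lemma nn_integral_gain_powr_finite_pos:
  assumes d_pos: "d \<ge> 1" and I_finite: "finite I" and \<kappa>_nonneg: "\<kappa> \<ge> 0" and s_pos: "s > 0"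
  shows "(\<integral>\<^sup>+w. ennreal (gain \<kappa> I d w powr s) \<partial>P) < \<infinity>"
proof -
  define J where "J = I \<times> {..<d}"
  have J_finite: "finite J" using I_finite by (simp add: J_def)
  obtain K where "K > 0" and powr_le_exp: "\<And>x. x \<ge> 0 \<Longrightarrow> (1 + \<kappa> * x) powr s \<le> K * exp (1 / (4 * v) * x)"
    using affine_powr_le_exp[of \<kappa> "1 / (4 * v)" s] \<kappa>_nonneg s_pos v_pos by auto
  have "gain \<kappa> I d w powr s \<le> K * (\<Prod>j\<in>J. exp ((w j)\<^sup>2 / (4 * v)))" for w
  proof -
    have "gain \<kappa> I d w powr s \<le> (1 + \<kappa> * (\<Sum>j\<in>J. (w j)\<^sup>2)) powr s"
      using gain_le[OF d_pos \<kappa>_nonneg] s_pos by (intro powr_mono2) (auto simp: J_def)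
    also have "\<dots> \<le> K * exp (1 / (4 * v) * (\<Sum>j\<in>J. (w j)\<^sup>2))"
      by (intro powr_le_exp sum_nonneg) simp
    also have "exp (1 / (4 * v) * (\<Sum>j\<in>J. (w j)\<^sup>2)) = (\<Prod>j\<in>J. exp ((w j)\<^sup>2 / (4 * v)))"
      using J_finite by (simp add: exp_sum[symmetric] sum_divide_distrib)
    finally show ?thesis .
  qed
  then have "(\<integral>\<^sup>+w. ennreal (gain \<kappa> I d w powr s) \<partial>P)
      \<le> (\<integral>\<^sup>+w. ennreal K * (\<Prod>j\<in>J. ennreal (exp ((w j)\<^sup>2 / (4 * v)))) \<partial>P)"
    using \<open>K > 0\<close>
    by (intro nn_integral_mono) (simp add: prod_ennreal ennreal_mult'[symmetric] ennreal_leI)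
  also have "\<dots> = ennreal K * (\<integral>\<^sup>+w. (\<Prod>j\<in>J. ennreal (exp ((w j)\<^sup>2 / (4 * v)))) \<partial>P)"
    by (rule nn_integral_cmult) measurable
  also have "\<dots> = ennreal K * ennreal (sqrt 2) ^ card J"
    using J_finite by (subst data.nn_integral_PiM_prod) (simp_all add: nn_integral_N_exp_square)
  also have "\<dots> < \<infinity>"
    by (simp add: ennreal_power ennreal_mult_less_top)
  finally show ?thesis .
qed

lemma AE_N_quadratic_nonzero:
  assumes "\<kappa> \<noteq> 0"
  shows "AE x in N. C - \<kappa> * x\<^sup>2 \<noteq> 0"
proof -
  have "x \<in> {sqrt (C / \<kappa>), - sqrt (C / \<kappa>)}" if "C - \<kappa> * x\<^sup>2 = 0" for x
  proof -
    have "C / \<kappa> = x\<^sup>2" using that assms by (simp add: field_simps)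
    then have "sqrt (C / \<kappa>) = \<bar>x\<bar>" by simp
    then show ?thesis by auto
  qed
  then have "{x. C - \<kappa> * x\<^sup>2 = 0} \<subseteq> {sqrt (C / \<kappa>), - sqrt (C / \<kappa>)}"
    by blast
  then have "finite {x. C - \<kappa> * x\<^sup>2 = 0}"
    by (rule finite_subset) simp
  then have "AE x in lborel. x \<notin> {x. C - \<kappa> * x\<^sup>2 = 0}"
    by (intro AE_not_in finite_imp_null_set_lborel)
  then show ?thesis by (auto simp: AE_density)
qed

lemma nn_integral_N_abs_diff_powr_bounded:
  assumes a_bounds: "- 1 < a" "a < 0"
  obtains K where "K < \<infinity>" "\<And>r. (\<integral>\<^sup>+x. ennreal (\<bar>x - r\<bar> powr a) \<partial>N) \<le> K"
proof -
  define c where "c = 1 / sqrt (2 * pi * v)"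
  define K where "K = 1 + ennreal c * (2 * ennreal (1 / (a + 1)))"
  have "(\<integral>\<^sup>+x. ennreal (\<bar>x - r\<bar> powr a) \<partial>N) \<le> K" for r
  proof -
    let ?near = "\<lambda>x. ennreal (indicator {-1..1} (x - r) * \<bar>x - r\<bar> powr a)"
    have "\<bar>x - r\<bar> powr a \<le> 1 + indicator {-1..1} (x - r) * \<bar>x - r\<bar> powr a" for x
    proof (cases "\<bar>x - r\<bar> \<le> 1")
      case True
      then show ?thesis by (simp add: abs_le_iff minus_le_iff)
    next
      case False
      then have "\<bar>x - r\<bar> powr a \<le> \<bar>x - r\<bar> powr 0"
        using a_bounds by (intro powr_mono) auto
      also have "\<dots> = 1" using False by auto
      finally show ?thesis by (rule order_trans) simp
    qed
    then have "(\<integral>\<^sup>+x. ennreal (\<bar>x - r\<bar> powr a) \<partial>N) \<le> (\<integral>\<^sup>+x. 1 + ?near x \<partial>N)"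
      by (intro nn_integral_mono) (simp add: ennreal_leI flip: ennreal_1 ennreal_plus)
    also have "\<dots> = 1 + (\<integral>\<^sup>+x. ennreal (normal_density 0 (sqrt v) x) * ?near x \<partial>lborel)"
      by (subst nn_integral_add) (simp_all add: N.emeasure_space_1[simplified] nn_integral_density)
    also have "\<dots> \<le> 1 + (\<integral>\<^sup>+x. ennreal c * ?near x \<partial>lborel)"
      using v_pos by (intro add_left_mono nn_integral_mono mult_right_mono ennreal_leI)
        (simp_all add: normal_density_def c_def divide_right_mono)
    also have "\<dots> \<le> K"
      unfolding K_def using nn_integral_lborel_abs_powr_near_le[OF a_bounds(1)]
      by (subst nn_integral_cmult) (auto intro!: add_left_mono mult_left_mono)
    finally show ?thesis .
  qed
  moreover have "K < \<infinity>"
    by (simp add: K_def ennreal_mult_less_top)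
  ultimately show ?thesis by (intro that)
qed

lemma nn_integral_N_quadratic_powr_bounded:
  assumes s_bounds: "- (1/2) < s" "s < 0" and \<kappa>_pos: "\<kappa> > 0"
  obtains K where "K < \<infinity>" "\<And>C. (\<integral>\<^sup>+x. ennreal (\<bar>C - \<kappa> * x\<^sup>2\<bar> powr s) \<partial>N) \<le> K"
proof -
  obtain K where K_bound: "K < \<infinity>" "\<And>r. (\<integral>\<^sup>+x. ennreal (\<bar>x - r\<bar> powr (2 * s)) \<partial>N) \<le> K"
    using nn_integral_N_abs_diff_powr_bounded[of "2 * s"] s_bounds by auto
  have "(\<integral>\<^sup>+x. ennreal (\<bar>C - \<kappa> * x\<^sup>2\<bar> powr s) \<partial>N) \<le> ennreal (\<kappa> powr s) * (K + K)" for C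
  proof -
    define r where "r = sqrt \<bar>C / \<kappa>\<bar>"
    have "\<bar>C - \<kappa> * x\<^sup>2\<bar> powr s \<le> \<kappa> powr s * (\<bar>x - r\<bar> powr (2 * s) + \<bar>x - (- r)\<bar> powr (2 * s))"
      if "x\<^sup>2 \<noteq> \<bar>C / \<kappa>\<bar>" for x
    proof -
      have "\<bar>C - \<kappa> * x\<^sup>2\<bar> = \<kappa> * \<bar>C / \<kappa> - x\<^sup>2\<bar>"
        using \<kappa>_pos by (simp add: abs_mult_pos' right_diff_distrib)
      then show ?thesis
        using abs_diff_square_powr_le[OF s_bounds(2) that] \<kappa>_pos
        by (simp add: powr_mult r_def mult_left_mono)
    qed
    then have "(\<integral>\<^sup>+x. ennreal (\<bar>C - \<kappa> * x\<^sup>2\<bar> powr s) \<partial>N)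
        \<le> (\<integral>\<^sup>+x. ennreal (\<kappa> powr s)
          * (ennreal (\<bar>x - r\<bar> powr (2 * s)) + ennreal (\<bar>x - (- r)\<bar> powr (2 * s))) \<partial>N)"
      using AE_N_quadratic_nonzero[of 1 "\<bar>C / \<kappa>\<bar>"]
      by (intro nn_integral_mono_AE)
        (auto simp: ennreal_mult'[symmetric] ennreal_plus[symmetric] ennreal_leI simp del: ennreal_plus
          elim!: eventually_mono)
    also have "\<dots> = ennreal (\<kappa> powr s) * ((\<integral>\<^sup>+x. ennreal (\<bar>x - r\<bar> powr (2 * s)) \<partial>N)
        + (\<integral>\<^sup>+x. ennreal (\<bar>x - (- r)\<bar> powr (2 * s)) \<partial>N))"
      by (simp add: nn_integral_cmult nn_integral_add)
    also have "\<dots> \<le> ennreal (\<kappa> powr s) * (K + K)"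
      by (intro mult_left_mono add_mono K_bound(2)) simp
    finally show ?thesis .
  qed
  then show ?thesis
    using K_bound(1)
    by (intro that[of "ennreal (\<kappa> powr s) * (K + K)"]) (simp_all add: ennreal_mult_less_top)
qed

lemma abs_le_gain_fun_upd:
  assumes "d \<ge> 1" "finite I" "a \<in> I"
  shows "\<bar>1 - \<kappa> * (\<Sum>i\<in>I - {a}. (w (i, 0))\<^sup>2) - \<kappa> * x\<^sup>2\<bar> \<le> gain \<kappa> I d (w((a, 0) := x))"
proof -
  have "(\<Sum>i\<in>I. ((w((a, 0) := x)) (i, 0))\<^sup>2) = x\<^sup>2 + (\<Sum>i\<in>I - {a}. (w (i, 0))\<^sup>2)"
    using assms(2,3) by (simp add: sum.remove)
  then show ?thesis
    using abs_le_gain[OF assms(1), of \<kappa> "w((a, 0) := x)" I] by (simp add: algebra_simps)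
qed

lemma AE_gain_pos:
  assumes d_pos: "d \<ge> 1" and batch: "finite I" "I \<noteq> {}" and \<kappa>_pos: "\<kappa> > 0"
  shows "AE w in P. gain \<kappa> I d w > 0"
proof -
  obtain a where a_mem: "a \<in> I" using batch by auto
  show ?thesis
  proof (rule data.AE_PiM_fun_upd[of "(a, 0)"])
    fix w :: "nat \<times> nat \<Rightarrow> real"
    have "AE x in N. (1 - \<kappa> * (\<Sum>i\<in>I - {a}. (w (i, 0))\<^sup>2)) - \<kappa> * x\<^sup>2 \<noteq> 0"
      using \<kappa>_pos by (intro AE_N_quadratic_nonzero) simp
    then show "AE x in N. gain \<kappa> I d (w((a, 0) := x)) > 0"
    proof eventually_elim
      case (elim x)
      then show ?case
        using abs_le_gain_fun_upd[OF d_pos batch(1) a_mem, of \<kappa> w x] by linarith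
    qed
  qed simp_all
qed

lemma nn_integral_gain_powr_finite_neg:
  assumes d_pos: "d \<ge> 1" and batch: "finite I" "I \<noteq> {}" and \<kappa>_pos: "\<kappa> > 0"
    and s_bounds: "- (1/2) < s" "s < 0"
  shows "(\<integral>\<^sup>+w. ennreal (gain \<kappa> I d w powr s) \<partial>P) < \<infinity>"
proof -
  obtain a where a_mem: "a \<in> I" using batch by auto
  obtain K where K_bound: "K < \<infinity>" "\<And>C. (\<integral>\<^sup>+x. ennreal (\<bar>C - \<kappa> * x\<^sup>2\<bar> powr s) \<partial>N) \<le> K"
    using nn_integral_N_quadratic_powr_bounded[OF s_bounds \<kappa>_pos] by blast
  have "(\<integral>\<^sup>+x. ennreal (gain \<kappa> I d (w((a, 0) := x)) powr s) \<partial>N) \<le> K" for w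
  proof -
    define C where "C = 1 - \<kappa> * (\<Sum>i\<in>I - {a}. (w (i, 0))\<^sup>2)"
    have "AE x in N. C - \<kappa> * x\<^sup>2 \<noteq> 0"
      using \<kappa>_pos by (intro AE_N_quadratic_nonzero) simp
    then have "AE x in N. gain \<kappa> I d (w((a, 0) := x)) powr s \<le> \<bar>C - \<kappa> * x\<^sup>2\<bar> powr s"
    proof eventually_elim
      case (elim x)
      then show ?case
        using abs_le_gain_fun_upd[OF d_pos batch(1) a_mem, of \<kappa> w x] s_bounds(2)
        by (intro powr_mono2') (auto simp: C_def)
    qed
    then have "(\<integral>\<^sup>+x. ennreal (gain \<kappa> I d (w((a, 0) := x)) powr s) \<partial>N)
        \<le> (\<integral>\<^sup>+x. ennreal (\<bar>C - \<kappa> * x\<^sup>2\<bar> powr s) \<partial>N)"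
      by (intro nn_integral_mono_AE) (auto elim!: eventually_mono intro: ennreal_leI)
    also have "\<dots> \<le> K" by (rule K_bound(2))
    finally show ?thesis .
  qed
  then have "(\<integral>\<^sup>+w. \<integral>\<^sup>+x. ennreal (gain \<kappa> I d (w((a, 0) := x)) powr s) \<partial>N \<partial>P) \<le> (\<integral>\<^sup>+w. K \<partial>P)"
    by (intro nn_integral_mono)
  also have "\<dots> = K" by (simp add: data.P.emeasure_space_1[simplified])
  finally show ?thesis
    using K_bound(1) by (subst data.nn_integral_PiM_fun_upd[of "(a, 0)"]) (auto intro: le_less_trans)
qed

lemma positive_rv_gain:
  assumes d_pos: "d \<ge> 1" and batch: "finite I" "I \<noteq> {}" and \<kappa>_pos: "\<kappa> > 0"
  shows "positive_rv P (gain \<kappa> I d) (1/2)"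
proof unfold_locales
  show "AE w in P. gain \<kappa> I d w > 0" by (rule AE_gain_pos[OF assms])
  show "integrable P (\<lambda>w. gain \<kappa> I d w powr s)" if "- (1/2) < s" for s
  proof -
    consider (positive) "s > 0" | (zero) "s = 0" | (negative) "s < 0" by linarith
    then have "(\<integral>\<^sup>+w. ennreal (gain \<kappa> I d w powr s) \<partial>P) < \<infinity>"
    proof cases
      case positive
      then show ?thesis using d_pos batch \<kappa>_pos by (intro nn_integral_gain_powr_finite_pos) auto
    next
      case zero
      then have "(\<integral>\<^sup>+w. ennreal (gain \<kappa> I d w powr s) \<partial>P) \<le> (\<integral>\<^sup>+w. 1 \<partial>P)"
        by (intro nn_integral_mono) simp
      then show ?thesis
        by (simp add: data.P.emeasure_space_1[simplified] le_less_trans[OF _ ennreal_one_less_top])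
    next
      case negative
      then show ?thesis using that by (intro nn_integral_gain_powr_finite_neg[OF assms])
    qed
    then show ?thesis by (intro integrableI_bounded) auto
  qed
qed simp_all

lemma emeasure_gain_gt_1:
  assumes d_pos: "d \<ge> 1" and batch: "finite I" "I \<noteq> {}" and \<kappa>_pos: "\<kappa> > 0"
  shows "emeasure P {w \<in> space P. gain \<kappa> I d w > 1} \<noteq> 0"
proof -
  have "1 \<le> real (card I)" using batch by (simp add: Suc_leI card_gt_0_iff)
  then have "1 < gain \<kappa> I d (\<lambda>_. sqrt (3 / \<kappa>))"
    using abs_le_gain[OF d_pos, of \<kappa> "\<lambda>_. sqrt (3 / \<kappa>)" I] \<kappa>_pos by simp
  moreover have "open {w. 1 < gain \<kappa> I d w}"
    by (intro open_Collect_less continuous_intros)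
  ultimately show ?thesis
    using emeasure_P_open_pos[of "{w. 1 < gain \<kappa> I d w}"] by simp
qed

end

section \<open>The functions h and rho\<close>

lemma tendsto_root_of_geometric_bounds:
  fixes a :: "nat \<Rightarrow> real"
  assumes "0 \<le> g" "0 < C" and lower: "\<And>k. g ^ k \<le> a k" and upper: "\<And>k. a k \<le> C * g ^ k"
  shows "(\<lambda>k. a k powr (1 / real k)) \<longlonglongrightarrow> g"
proof (rule real_tendsto_sandwich)
  have root: "(g ^ k) powr (1 / real k) = g" if "k > 0" for k
    using assms(1) that by (simp add: root_powr_inverse[symmetric] real_root_power_cancel)
  show "\<forall>\<^sub>F k in sequentially. g \<le> a k powr (1 / real k)"
    using eventually_gt_at_top[of 0]
  proof eventually_elim
    case (elim k)
    have "(g ^ k) powr (1 / real k) \<le> a k powr (1 / real k)"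
      using assms(1) by (intro powr_mono2 lower) simp_all
    then show ?case by (simp only: root[OF elim])
  qed
  show "\<forall>\<^sub>F k in sequentially. a k powr (1 / real k) \<le> C powr (1 / real k) * g"
    using eventually_gt_at_top[of 0]
  proof eventually_elim
    case (elim k)
    have "0 \<le> a k"
      using lower[of k] assms(1) by (meson order_trans zero_le_power)
    then have "a k powr (1 / real k) \<le> (C * g ^ k) powr (1 / real k)"
      by (intro powr_mono2 upper) simp_all
    also have "\<dots> = C powr (1 / real k) * g"
      using assms(1,2) by (simp add: powr_mult root[OF elim])
    finally show ?case .
  qed
  have "(\<lambda>k. C powr (1 / real k) * g) \<longlonglongrightarrow> C powr 0 * g"
    using assms(2) by (intro tendsto_intros lim_1_over_n) auto
  then show "(\<lambda>k. C powr (1 / real k) * g) \<longlonglongrightarrow> g"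
    using assms(2) by simp
qed simp

lemma sum_powr_le:
  fixes x :: "'j \<Rightarrow> real"
  assumes J_finite: "finite J" and nonneg: "\<And>j. j \<in> J \<Longrightarrow> x j \<ge> 0" and s_pos: "s > 0"
  shows "(\<Sum>j\<in>J. x j) powr s \<le> real (card J) powr s * (\<Sum>j\<in>J. x j powr s)"
proof (cases "J = {}")
  case False
  then have "Max (x ` J) \<in> x ` J"
    using J_finite by (intro Max_in) auto
  then obtain i where "i \<in> J" and Max_attained: "Max (x ` J) = x i"
    by auto
  have x_le_max: "x j \<le> x i" if "j \<in> J" for j
    unfolding Max_attained[symmetric] using J_finite that by (intro Max_ge) auto
  have "(\<Sum>j\<in>J. x j) \<le> real (card J) * x i"
    using x_le_max by (rule sum_bounded_above)
  then have "(\<Sum>j\<in>J. x j) powr s \<le> (real (card J) * x i) powr s"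
    using s_pos nonneg by (intro powr_mono2) (simp_all add: sum_nonneg)
  also have "\<dots> = real (card J) powr s * x i powr s"
    by (rule powr_mult)
  also have "\<dots> \<le> real (card J) powr s * (\<Sum>j\<in>J. x j powr s)"
    using \<open>i \<in> J\<close> J_finite by (intro mult_left_mono member_le_sum) simp_all
  finally show ?thesis .
qed simp

lemma ln_sum_div_less:
  fixes x :: "'j \<Rightarrow> real"
  assumes indices: "finite J" "J \<noteq> {}" and "k > 0"
    and x_bounds: "\<And>j. j \<in> J \<Longrightarrow> 0 < x j" "\<And>j. j \<in> J \<Longrightarrow> ln (x j) / k < b"
  shows "ln (\<Sum>j\<in>J. x j) / k < ln (real (card J)) / k + b"
proof -
  have "x j < exp (k * b)" if "j \<in> J" for j
    using x_bounds[OF that] \<open>k > 0\<close> exp_less_cancel_iff[of "ln (x j)" "k * b"]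
    by (simp add: pos_divide_less_eq mult.commute)
  then have "(\<Sum>j\<in>J. x j) < real (card J) * exp (k * b)"
    using indices sum_strict_mono[of J x "\<lambda>_. exp (k * b)"] by simp
  then have "ln (\<Sum>j\<in>J. x j) < ln (real (card J) * exp (k * b))"
    using indices x_bounds by (intro ln_strict_mono sum_pos) auto
  also have "\<dots> = ln (real (card J)) + k * b"
    using indices by (subst ln_mult) (auto simp: card_gt_0_iff)
  finally show ?thesis
    using \<open>k > 0\<close> by (simp add: field_simps)
qed

lemma tendsto_ln_div_of_sum_bounds:
  fixes X :: "'j \<Rightarrow> nat \<Rightarrow> real"
  assumes indices: "finite J" "i \<in> J" and X_pos: "\<And>j k. j \<in> J \<Longrightarrow> X j k > 0"
    and X_limit: "\<And>j. j \<in> J \<Longrightarrow> (\<lambda>k. ln (X j k) / real k) \<longlonglongrightarrow> l"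
    and lower: "\<And>k. X i k \<le> \<sigma> k" and upper: "\<And>k. \<sigma> k \<le> (\<Sum>j\<in>J. X j k)"
  shows "(\<lambda>k. ln (\<sigma> k) / real k) \<longlonglongrightarrow> l"
proof (rule order_tendstoI)
  have \<sigma>_pos: "\<sigma> k > 0" for k
    using X_pos[OF indices(2)] lower by (rule less_le_trans)
  fix a
  show "\<forall>\<^sub>F k in sequentially. a < ln (\<sigma> k) / real k" if "a < l"
    using order_tendstoD(1)[OF X_limit[OF indices(2)] that]
  proof eventually_elim
    case (elim k)
    also have "ln (X i k) / real k \<le> ln (\<sigma> k) / real k"
      using X_pos[OF indices(2)] lower by (intro divide_right_mono ln_mono) simp_all
    finally show ?case .
  qed
  assume "l < a"
  then obtain b where b_between: "l < b" "b < a" using dense by blast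
  have "\<forall>\<^sub>F k in sequentially. \<forall>j\<in>J. ln (X j k) / real k < b"
    using indices(1) order_tendstoD(2)[OF X_limit b_between(1)] by (intro eventually_ball_finite) auto
  moreover have "\<forall>\<^sub>F k in sequentially. ln (real (card J)) / real k < a - b"
    using b_between(2) by (intro order_tendstoD(2)[OF lim_const_over_n]) simp
  ultimately show "\<forall>\<^sub>F k in sequentially. ln (\<sigma> k) / real k < a"
    using eventually_gt_at_top[of 0]
  proof eventually_elim
    case (elim k)
    have "ln (\<sigma> k) / real k \<le> ln (\<Sum>j\<in>J. X j k) / real k"
      using \<sigma>_pos upper by (intro divide_right_mono ln_mono) simp_all
    also have "\<dots> < ln (real (card J)) / real k + b"
      using indices X_pos elim(1,3) by (intro ln_sum_div_less) auto
    finally show ?case using elim(2) by linarith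
  qed
qed

lemma Mmat_carrier [simp]: "Mmat \<eta> b d w k \<in> carrier_mat d d"
  by (auto simp: Mmat_def Hmat_def)

lemma Pimat_carrier [simp]: "Pimat \<eta> b d w k \<in> carrier_mat d d"
  by (induction k) (auto intro: mult_carrier_mat[OF Mmat_carrier])

lemma Mmat_mult_vec:
  "Mmat \<eta> b d w (Suc k) *\<^sub>v vec d u = vec d (sgd_step (\<eta> / real b) {b * k + 1 .. b * Suc k} d w u)"
proof (rule eq_vecI)
  let ?I = "{b * k + 1 .. b * Suc k}" and ?\<kappa> = "\<eta> / real b"
  fix p assume "p < dim_vec (vec d (sgd_step ?\<kappa> ?I d w u))"
  then have p_less: "p < d" by simp
  have "(Mmat \<eta> b d w (Suc k) *\<^sub>v vec d u) $ p
      = (\<Sum>q<d. (if p = q then u q else 0) - ?\<kappa> * (\<Sum>i\<in>?I. w (i, p) * (w (i, q) * u q)))"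
    using p_less
    by (auto simp: Mmat_def Hmat_def avec_def scalar_prod_def lessThan_atLeast0 left_diff_distrib
        sum_distrib_right sum_distrib_left mult.assoc intro!: sum.cong)
  also have "\<dots> = u p - ?\<kappa> * (\<Sum>q<d. \<Sum>i\<in>?I. w (i, p) * (w (i, q) * u q))"
    using p_less by (simp add: sum_subtractf sum_distrib_left)
  also have "\<dots> = sgd_step ?\<kappa> ?I d w u p"
    unfolding sgd_step_def by (subst sum.swap) (simp add: sum_distrib_left)
  finally show "(Mmat \<eta> b d w (Suc k) *\<^sub>v vec d u) $ p = vec d (sgd_step ?\<kappa> ?I d w u) $ p"
    using p_less by simp
qed (simp add: Mmat_def Hmat_def)

lemma Pimat_mult_vec: "Pimat \<eta> b d w k *\<^sub>v vec d u = vec d (sgd_iter (\<eta> / real b) b d w k u)"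
proof (induction k)
  case (Suc k)
  have "Pimat \<eta> b d w (Suc k) *\<^sub>v vec d u = Mmat \<eta> b d w (Suc k) *\<^sub>v (Pimat \<eta> b d w k *\<^sub>v vec d u)"
    by (simp add: assoc_mult_mat_vec[OF Mmat_carrier Pimat_carrier])
  then show ?case
    by (simp only: Suc.IH Mmat_mult_vec sgd_iter.simps)
qed simp

lemma unit_vec_eq_vec_indicator: "unit_vec d j = vec d (indicator {j})"
  by (auto simp: unit_vec_def)

locale sgd = gaussian_data +
  fixes \<eta> :: real and b d :: nat
  assumes \<eta>_pos: "\<eta> > 0" and b_pos: "b \<ge> 1" and d_pos: "d \<ge> 1"
begin

definition batch_gain :: "(nat \<times> nat \<Rightarrow> real) \<Rightarrow> real" where
  "batch_gain = gain (\<eta> / real b) {1..b} d"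

sublocale rv: positive_rv P batch_gain "1/2"
  unfolding batch_gain_def using \<eta>_pos b_pos d_pos by (intro positive_rv_gain) auto

abbreviation column_norm :: "nat \<Rightarrow> nat \<Rightarrow> (nat \<times> nat \<Rightarrow> real) \<Rightarrow> real" where
  "column_norm j k w \<equiv> coord_norm d (sgd_iter (\<eta> / real b) b d w k (indicator {j}))"

abbreviation Pimat_norm :: "nat \<Rightarrow> (nat \<times> nat \<Rightarrow> real) \<Rightarrow> real" where
  "Pimat_norm k w \<equiv> spec_norm d (Pimat \<eta> b d w k)"

lemma vnorm_Pimat_unit_vec: "vnorm (Pimat \<eta> b d w k *\<^sub>v unit_vec d j) = column_norm j k w"
  by (simp add: unit_vec_eq_vec_indicator Pimat_mult_vec)

lemma column_norm_le_Pimat_norm: "j < d \<Longrightarrow> column_norm j k w \<le> Pimat_norm k w"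
  using vnorm_le_spec_norm[of "Pimat \<eta> b d w k" d d "unit_vec d j"]
  by (simp add: vnorm_unit_vec vnorm_Pimat_unit_vec)

lemma Pimat_norm_le_sum_column_norm: "Pimat_norm k w \<le> (\<Sum>j<d. column_norm j k w)"
  using spec_norm_le_sum_columns[of "Pimat \<eta> b d w k" d d] d_pos by (simp add: vnorm_Pimat_unit_vec)

lemma Pimat_norm_nonneg: "Pimat_norm k w \<ge> 0"
  using d_pos by (intro spec_norm_nonneg[OF Pimat_carrier])

lemma measurable_Pimat_norm [measurable]: "Pimat_norm k \<in> borel_measurable P"
proof (rule borel_measurableI_greater)
  fix c
  have "{w. c < Pimat_norm k w}
      = (\<Union>x\<in>{x \<in> carrier_vec d. vnorm x = 1}. {w. c < vnorm (Pimat \<eta> b d w k *\<^sub>v x)})"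
    using d_pos by (auto simp: less_spec_norm_iff[OF Pimat_carrier])
  moreover have "open {w. c < vnorm (Pimat \<eta> b d w k *\<^sub>v x)}" if "x \<in> carrier_vec d" for x
  proof -
    have "vec d (\<lambda>j. x $ j) = x" using that by auto
    then have "vnorm (Pimat \<eta> b d w k *\<^sub>v x) = coord_norm d (sgd_iter (\<eta> / real b) b d w k (\<lambda>j. x $ j))"
      for w
      using Pimat_mult_vec[of \<eta> b d w k "\<lambda>j. x $ j"] by simp
    then show ?thesis
      by (simp only:) (intro open_Collect_less continuous_intros)
  qed
  ultimately have "open {w. c < Pimat_norm k w}" by auto
  then show "{w \<in> space P. c < Pimat_norm k w} \<in> sets P"
    by (simp add: sets_P)
qed

lemma nn_integral_column_norm_powr:
  assumes "s > - (1/2)" "j < d"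
  shows "(\<integral>\<^sup>+w. ennreal (column_norm j k w powr s) \<partial>P) = ennreal (rv.g s ^ k)"
proof -
  have "(\<integral>\<^sup>+w. ennreal (batch_gain w powr s) \<partial>P) = ennreal (rv.g s)"
    unfolding power_moment_def using rv.integrable_powr[OF assms(1)]
    by (intro nn_integral_eq_integral) auto
  then show ?thesis
    unfolding nn_integral_sgd_iter_powr[OF d_pos] batch_gain_def[symmetric]
    using assms(2) rv.g_nonneg by (simp add: ennreal_power)
qed

lemma moment_Pimat_norm_bounds:
  assumes s_pos: "s > 0"
  shows "rv.g s ^ k \<le> (\<integral>w. Pimat_norm k w powr s \<partial>P)"
    and "(\<integral>w. Pimat_norm k w powr s \<partial>P) \<le> real d powr s * d * rv.g s ^ k"
proof -
  let ?n = "\<integral>\<^sup>+w. ennreal (Pimat_norm k w powr s) \<partial>P"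
  have g_power_nonneg: "rv.g s ^ k \<ge> 0" by (simp add: rv.g_nonneg)
  have "Pimat_norm k w powr s \<le> real d powr s * (\<Sum>j<d. column_norm j k w powr s)" for w
  proof -
    have "Pimat_norm k w powr s \<le> (\<Sum>j<d. column_norm j k w) powr s"
      using s_pos by (intro powr_mono2 Pimat_norm_le_sum_column_norm Pimat_norm_nonneg) simp
    also have "\<dots> \<le> real d powr s * (\<Sum>j<d. column_norm j k w powr s)"
      using sum_powr_le[of "{..<d}" "\<lambda>j. column_norm j k w" s] s_pos by simp
    finally show ?thesis .
  qed
  then have "?n \<le> (\<integral>\<^sup>+w. ennreal (real d powr s) * (\<Sum>j<d. ennreal (column_norm j k w powr s)) \<partial>P)"
    by (intro nn_integral_mono) (simp add: sum_ennreal ennreal_mult'[symmetric] sum_nonneg ennreal_leI)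
  also have "\<dots> = ennreal (real d powr s) * (\<Sum>j<d. \<integral>\<^sup>+w. ennreal (column_norm j k w powr s) \<partial>P)"
    by (subst nn_integral_cmult, measurable, subst nn_integral_sum) auto
  also have "\<dots> = ennreal (real d powr s * d * rv.g s ^ k)"
    using s_pos g_power_nonneg
    by (simp add: nn_integral_column_norm_powr ennreal_mult' ennreal_of_nat_eq_real_of_nat mult.assoc)
  finally have upper: "?n \<le> ennreal (real d powr s * d * rv.g s ^ k)" .
  have "ennreal (rv.g s ^ k) = (\<integral>\<^sup>+w. ennreal (column_norm 0 k w powr s) \<partial>P)"
    using s_pos d_pos by (simp add: nn_integral_column_norm_powr)
  also have "\<dots> \<le> ?n"
    using s_pos d_pos by (intro nn_integral_mono ennreal_leI powr_mono2 column_norm_le_Pimat_norm) auto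
  finally have lower: "ennreal (rv.g s ^ k) \<le> ?n" .
  have "integrable P (\<lambda>w. Pimat_norm k w powr s)"
    using upper by (intro integrableI_bounded) (auto intro: le_less_trans)
  then have nn_integral_eq: "?n = ennreal (\<integral>w. Pimat_norm k w powr s \<partial>P)"
    by (intro nn_integral_eq_integral) auto
  show "rv.g s ^ k \<le> (\<integral>w. Pimat_norm k w powr s \<partial>P)"
    using lower unfolding nn_integral_eq by (simp add: ennreal_le_iff)
  show "(\<integral>w. Pimat_norm k w powr s \<partial>P) \<le> real d powr s * d * rv.g s ^ k"
    using upper g_power_nonneg unfolding nn_integral_eq by (simp add: ennreal_le_iff)
qed

lemma hfun_eq_power_moment:
  assumes "s > 0"
  shows "hfun \<eta> v b d s = rv.g s"
  unfolding hfun_def data_space_eq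
  using d_pos by (intro limI tendsto_root_of_geometric_bounds[where C="real d powr s * d"] rv.g_nonneg
      moment_Pimat_norm_bounds assms) auto

lemma AE_lyapunov_exponent:
  "AE w in P. (\<lambda>k. ln (lambda_max (gram (Pimat \<eta> b d w k))) / (2 * real k)) \<longlonglongrightarrow> rv.\<gamma>"
proof -
  have "AE w in P. \<forall>k. column_norm j k w > 0" "AE w in P. (\<lambda>k. ln (column_norm j k w) / real k) \<longlonglongrightarrow> rv.\<gamma>"
    if "j < d" for j
    using data.P.prob_space_axioms nn_integral_column_norm_powr that
    by (intro rv.AE_ln_div_tendsto; simp)+
  then have "AE w in P. \<forall>j\<in>{..<d}.
      (\<forall>k. column_norm j k w > 0) \<and> (\<lambda>k. ln (column_norm j k w) / real k) \<longlonglongrightarrow> rv.\<gamma>"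
    by (intro AE_finite_allI AE_conjI) auto
  then show ?thesis
  proof eventually_elim
    case (elim w)
    have first_axis: "0 \<in> {..<d}" using d_pos by simp
    then have "0 < column_norm 0 k w" "column_norm 0 k w \<le> Pimat_norm k w" for k
      using elim column_norm_le_Pimat_norm by auto
    then have Pimat_norm_pos: "0 < Pimat_norm k w" for k
      by (rule less_le_trans)
    have "(\<lambda>k. ln (Pimat_norm k w) / real k) \<longlonglongrightarrow> rv.\<gamma>"
    proof (rule tendsto_ln_div_of_sum_bounds[OF finite_lessThan first_axis])
      show "(\<lambda>k. ln (column_norm j k w) / real k) \<longlonglongrightarrow> rv.\<gamma>" "0 < column_norm j k w" if "j \<in> {..<d}" for j k
        using elim that by auto
      show "column_norm 0 k w \<le> Pimat_norm k w" "Pimat_norm k w \<le> (\<Sum>j<d. column_norm j k w)" for k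
        using first_axis by (intro column_norm_le_Pimat_norm Pimat_norm_le_sum_column_norm; simp)+
    qed
    then show ?case
      using Pimat_norm_pos by (simp add: lambda_max_gram[OF Pimat_carrier d_pos] ln_realpow)
  qed
qed

lemma rho_eq_log_mean: "rho \<eta> v b d = rv.\<gamma>"
  unfolding rho_def data_space_eq
proof (rule the_equality)
  fix r
  assume "AE w in P. (\<lambda>k. ln (lambda_max (gram (Pimat \<eta> b d w k))) / (2 * real k)) \<longlonglongrightarrow> r"
  with AE_lyapunov_exponent have "AE w in P. r = rv.\<gamma>"
    by eventually_elim (rule LIMSEQ_unique)
  then show "r = rv.\<gamma>" by simp
qed (rule AE_lyapunov_exponent)

end

lemma admissible_imp_sgd: "admissible \<eta> v b d \<Longrightarrow> sgd v \<eta> b d"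
  by (simp add: admissible_def sgd_def sgd_axioms_def gaussian_data_def)

lemma tail_index_crossing:
  assumes "admissible \<eta> v b d"
  shows tail_index_pos: "tail_index \<eta> v b d > 0"
    and hfun_tail_index: "hfun \<eta> v b d (tail_index \<eta> v b d) = 1"
    and hfun_less_1_iff: "s > 0 \<Longrightarrow> hfun \<eta> v b d s < 1 \<longleftrightarrow> s < tail_index \<eta> v b d"
    and hfun_greater_1_iff: "s > 0 \<Longrightarrow> 1 < hfun \<eta> v b d s \<longleftrightarrow> tail_index \<eta> v b d < s"
proof -
  interpret sgd v \<eta> b d by (rule admissible_imp_sgd[OF assms])
  have "rv.\<gamma> < 0"
    using assms by (simp add: admissible_def rho_eq_log_mean)
  moreover have "emeasure P {w \<in> space P. batch_gain w > 1} \<noteq> 0"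
    unfolding batch_gain_def using \<eta>_pos b_pos d_pos by (intro emeasure_gain_gt_1) auto
  ultimately obtain \<alpha> where crossing: "\<alpha> > 0"
    "\<And>s. s > 0 \<Longrightarrow> rv.g s = 1 \<longleftrightarrow> s = \<alpha>" "\<And>s. s > 0 \<Longrightarrow> rv.g s < 1 \<longleftrightarrow> s < \<alpha>"
    using rv.g_crosses_1 by blast
  have "tail_index \<eta> v b d = \<alpha>"
    unfolding tail_index_def using crossing(1,2)
    by (intro the_equality) (auto simp: hfun_eq_power_moment)
  then show "tail_index \<eta> v b d > 0" "hfun \<eta> v b d (tail_index \<eta> v b d) = 1"
    and "s > 0 \<Longrightarrow> hfun \<eta> v b d s < 1 \<longleftrightarrow> s < tail_index \<eta> v b d"
    and "s > 0 \<Longrightarrow> 1 < hfun \<eta> v b d s \<longleftrightarrow> tail_index \<eta> v b d < s"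
    using crossing(1) crossing(2)[of \<alpha>] crossing(2,3)[of s] by (auto simp: hfun_eq_power_moment)
qed

section \<open>Comparison of the functions h\<close>

lemma (in finite_measure) integral_L2_set_powr_convex_less:
  fixes u :: "'j \<Rightarrow> 'a \<Rightarrow> 'i \<Rightarrow> real"
  assumes indices: "finite J" "i \<in> J" "j \<in> J"
    and weights: "\<And>j. j \<in> J \<Longrightarrow> c j > 0" "(\<Sum>j\<in>J. c j) = 1" and s_ge_1: "s \<ge> 1"
    and integrable_mix: "integrable M (\<lambda>x. L2_set (\<lambda>k. \<Sum>j\<in>J. c j * u j x k) A powr s)"
    and integrable_each: "\<And>j. j \<in> J \<Longrightarrow> integrable M (\<lambda>x. L2_set (u j x) A powr s)"
    and E_positive: "E \<in> sets M" "emeasure M E \<noteq> 0" and coords: "finite A" "k \<in> A"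
    and signs: "\<And>x. x \<in> E \<Longrightarrow> u i x k > 0" "\<And>x. x \<in> E \<Longrightarrow> u j x k < 0"
  shows "(\<integral>x. L2_set (\<lambda>k. \<Sum>j\<in>J. c j * u j x k) A powr s \<partial>M)
      < (\<Sum>j\<in>J. c j * (\<integral>x. L2_set (u j x) A powr s \<partial>M))"
proof -
  have "(\<integral>x. L2_set (\<lambda>k. \<Sum>j\<in>J. c j * u j x k) A powr s \<partial>M)
      < (\<integral>x. (\<Sum>j\<in>J. c j * L2_set (u j x) A powr s) \<partial>M)"
  proof (rule integral_less_AE[OF integrable_mix _ E_positive(2,1)])
    show "integrable M (\<lambda>x. \<Sum>j\<in>J. c j * L2_set (u j x) A powr s)"
      using integrable_each by simp
    show "AE x in M. x \<in> E \<longrightarrow>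
        L2_set (\<lambda>k. \<Sum>j\<in>J. c j * u j x k) A powr s \<noteq> (\<Sum>j\<in>J. c j * L2_set (u j x) A powr s)"
      using signs
      by (intro AE_I2 impI less_imp_neq L2_set_powr_convex_less[OF indices weights s_ge_1 coords])
    show "AE x in M. L2_set (\<lambda>k. \<Sum>j\<in>J. c j * u j x k) A powr s \<le> (\<Sum>j\<in>J. c j * L2_set (u j x) A powr s)"
      using indices weights s_ge_1 by (intro AE_I2 L2_set_powr_convex_le) (auto intro: less_imp_le)
  qed
  then show ?thesis using integrable_each by simp
qed

lemma first_column_leave_one_out:
  assumes J_card: "finite J" "card J = Suc b" and b_pos: "b \<ge> 1"
  shows "first_column (\<eta> / real (Suc b)) J w
    = (\<lambda>p. \<Sum>j\<in>J. 1 / real (Suc b) * first_column (\<eta> / real b) (J - {j}) w p)"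
proof
  fix p
  define y where "y i = w (i, p) * w (i, 0)" for i
  have "(\<Sum>j\<in>J. \<Sum>i\<in>J - {j}. y i) = real b * (\<Sum>i\<in>J. y i)"
    using J_card by (simp add: sum_diff1 sum_subtractf algebra_simps)
  then have "(\<Sum>j\<in>J. first_column (\<eta> / real b) (J - {j}) w p)
      = real (Suc b) * indicator {0} p - \<eta> / real b * (real b * (\<Sum>i\<in>J. y i))"
    using J_card
    by (simp add: first_column_def sum_subtractf sum_distrib_left[symmetric]
        sum_divide_distrib[symmetric] y_def)
  also have "\<eta> / real b * (real b * (\<Sum>i\<in>J. y i)) = \<eta> * (\<Sum>i\<in>J. y i)"
    using b_pos by simp
  finally show "first_column (\<eta> / real (Suc b)) J w p
      = (\<Sum>j\<in>J. 1 / real (Suc b) * first_column (\<eta> / real b) (J - {j}) w p)"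
    by (simp add: sum_divide_distrib[symmetric])
      (simp add: first_column_def y_def field_simps del: of_nat_Suc)
qed

context gaussian_data
begin

lemma integrable_gain_powr:
  assumes "d \<ge> 1" "finite I" "\<kappa> \<ge> 0" "s > 0"
  shows "integrable P (\<lambda>w. gain \<kappa> I d w powr s)"
  using nn_integral_gain_powr_finite_pos[OF assms] by (intro integrableI_bounded) auto

lemma power_moment_gain_convex_less:
  assumes d_pos: "d \<ge> 1" and s_ge_1: "s \<ge> 1" and indices: "finite J" "i \<in> J" "j \<in> J"
    and weights: "\<And>j. j \<in> J \<Longrightarrow> c j > 0" "(\<Sum>j\<in>J. c j) = 1"
    and parameters: "finite I" "\<kappa> \<ge> 0"
    and parameters': "\<And>j. j \<in> J \<Longrightarrow> finite (I' j)" "\<And>j. j \<in> J \<Longrightarrow> \<kappa>' j \<ge> 0"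
    and combination: "\<And>w. first_column \<kappa> I w = (\<lambda>p. \<Sum>j\<in>J. c j * first_column (\<kappa>' j) (I' j) w p)"
    and signs: "first_column (\<kappa>' i) (I' i) w 0 > 0" "first_column (\<kappa>' j) (I' j) w 0 < 0"
  shows "power_moment P (gain \<kappa> I d) s < (\<Sum>j\<in>J. c j * power_moment P (gain (\<kappa>' j) (I' j) d) s)"
proof -
  let ?E = "{w. first_column (\<kappa>' i) (I' i) w 0 > 0} \<inter> {w. first_column (\<kappa>' j) (I' j) w 0 < 0}"
  have "open ?E"
    by (intro open_Int open_Collect_less continuous_intros)
  moreover have "w \<in> ?E" using signs by simp
  ultimately have E_positive: "?E \<in> sets P" "emeasure P ?E \<noteq> 0"
    using emeasure_P_open_pos[of ?E w] by (simp only: sets_P borel_open, blast)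
  show ?thesis
    unfolding power_moment_def gain_def combination
  proof (rule data.P.integral_L2_set_powr_convex_less[OF indices weights s_ge_1 _ _ E_positive, where k=0])
    show "integrable P (\<lambda>w. coord_norm d (\<lambda>p. \<Sum>j\<in>J. c j * first_column (\<kappa>' j) (I' j) w p) powr s)"
      using integrable_gain_powr[of d I \<kappa> s] d_pos s_ge_1 parameters by (simp only: gain_def combination)
    show "integrable P (\<lambda>w. coord_norm d (first_column (\<kappa>' j) (I' j) w) powr s)" if "j \<in> J" for j
      using integrable_gain_powr[of d "I' j" "\<kappa>' j" s] d_pos s_ge_1 parameters' that
      by (simp add: gain_def)
  qed (use d_pos in auto)
qed

lemma power_moment_gain_stepsize:
  assumes d_pos: "d \<ge> 1" and batch: "finite I" "I \<noteq> {}" and stepsizes: "0 < \<kappa>1" "\<kappa>1 < \<kappa>2"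
    and s_ge_1: "s \<ge> 1"
  shows "power_moment P (gain \<kappa>1 I d) s < \<kappa>1 / \<kappa>2 * power_moment P (gain \<kappa>2 I d) s + (1 - \<kappa>1 / \<kappa>2)"
proof -
  define t where "t = \<kappa>1 / \<kappa>2"
  have t_bounds: "0 < t" "t < 1" "\<kappa>1 = t * \<kappa>2" using stepsizes by (simp_all add: t_def)
  let ?c = "\<lambda>j. if j then t else 1 - t" and ?\<kappa> = "\<lambda>j. if j then \<kappa>2 else 0"
  let ?w = "\<lambda>_ :: nat \<times> nat. sqrt (2 / \<kappa>2)"
  have "power_moment P (gain \<kappa>1 I d) s < (\<Sum>j\<in>UNIV. ?c j * power_moment P (gain (?\<kappa> j) I d) s)"
  proof (rule power_moment_gain_convex_less[OF d_pos s_ge_1, where i=False and j=True and w="?w"])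
    show "first_column \<kappa>1 I w = (\<lambda>p. \<Sum>j\<in>UNIV. ?c j * first_column (?\<kappa> j) I w p)" for w
      by (simp add: first_column_def t_bounds(3) UNIV_bool fun_eq_iff algebra_simps)
    have "1 \<le> real (card I)" using batch by (simp add: Suc_leI card_gt_0_iff)
    then show "first_column (?\<kappa> True) I ?w 0 < 0"
      using stepsizes by (simp add: first_column_def)
  qed (use t_bounds stepsizes batch in \<open>auto simp: UNIV_bool first_column_def\<close>)
  moreover have "gain 0 I d w = 1" for w
    using d_pos by (simp add: gain_def first_column_def)
  then have "power_moment P (gain 0 I d) s = 1"
    by (simp add: power_moment_def data.P.prob_space[simplified])
  ultimately show ?thesis
    by (simp add: UNIV_bool t_def[symmetric])
qed

lemma power_moment_gain_reindex:
  assumes "inj \<pi>"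
  shows "power_moment P (gain \<kappa> (\<pi> ` I) d) s = power_moment P (gain \<kappa> I d) s"
  using nn_integral_gain_reindex[of "\<lambda>x. ennreal (x powr s)", OF _ assms]
  by (simp add: power_moment_def integral_eq_nn_integral)

lemma power_moment_gain_leave_one_out:
  assumes "j \<in> {1..Suc b}"
  shows "power_moment P (gain \<kappa> ({1..Suc b} - {j}) d) s = power_moment P (gain \<kappa> {1..b} d) s"
proof -
  let ?\<tau> = "Transposition.transpose j (Suc b)"
  have "{1..b} = {1..Suc b} - {Suc b}" by auto
  then have "?\<tau> ` {1..b} = ?\<tau> ` {1..Suc b} - {j}"
    by (simp only: image_set_diff[OF inj_transpose]) simp
  then have "{1..Suc b} - {j} = ?\<tau> ` {1..b}"
    using assms by simp
  then show ?thesis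
    by (simp only: power_moment_gain_reindex[OF inj_transpose])
qed

lemma power_moment_gain_batch_Suc:
  assumes d_pos: "d \<ge> 1" and b_pos: "b \<ge> 1" and \<eta>_pos: "\<eta> > 0" and s_ge_1: "s \<ge> 1"
  shows "power_moment P (gain (\<eta> / real (Suc b)) {1..Suc b} d) s
      < power_moment P (gain (\<eta> / real b) {1..b} d) s"
proof -
  define J where "J = {1..Suc b}"
  define \<kappa> where "\<kappa> = \<eta> / real b"
  have J_members: "finite J" "card J = Suc b" "1 \<in> J" "Suc b \<in> J" by (simp_all add: J_def)
  have \<kappa>_pos: "\<kappa> > 0" using \<eta>_pos b_pos by (simp add: \<kappa>_def)
  define w where "w = (\<lambda>(i :: nat, p :: nat). if i = 1 then sqrt (2 / \<kappa>) else 0)"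
  have w_square: "(w (i, 0))\<^sup>2 = (if i = 1 then 2 / \<kappa> else 0)" for i
    using \<kappa>_pos by (simp add: w_def)
  have "power_moment P (gain (\<eta> / real (Suc b)) J d) s
      < (\<Sum>j\<in>J. 1 / real (Suc b) * power_moment P (gain \<kappa> (J - {j}) d) s)"
  proof (rule power_moment_gain_convex_less[OF d_pos s_ge_1 J_members(1,3,4), where w=w])
    show "first_column (\<eta> / real (Suc b)) J w'
        = (\<lambda>p. \<Sum>j\<in>J. 1 / real (Suc b) * first_column \<kappa> (J - {j}) w' p)"
      for w'
      unfolding \<kappa>_def using J_members b_pos by (intro first_column_leave_one_out) simp_all
    show "0 < first_column \<kappa> (J - {1}) w 0" "first_column \<kappa> (J - {Suc b}) w 0 < 0"
      using J_members b_pos \<kappa>_pos by (simp_all add: first_column_0 w_square)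
  qed (use J_members \<kappa>_pos \<eta>_pos in auto)
  also have "\<dots> = (\<Sum>j\<in>J. 1 / real (Suc b) * power_moment P (gain \<kappa> {1..b} d) s)"
    by (intro sum.cong refl arg_cong2[where f="(*)"]) (simp only: J_def power_moment_gain_leave_one_out)
  also have "\<dots> = power_moment P (gain \<kappa> {1..b} d) s"
    using J_members by simp
  finally show ?thesis by (simp only: J_def \<kappa>_def)
qed

lemma power_moment_gain_dim:
  assumes dims: "1 \<le> d1" "d1 < d2" and batch: "finite I" "I \<noteq> {}" and \<kappa>_pos: "\<kappa> > 0" and s_pos: "s > 0"
  shows "power_moment P (gain \<kappa> I d1) s < power_moment P (gain \<kappa> I d2) s"
  unfolding power_moment_def
proof (rule data.P.integral_less_AE)
  let ?E = "{w. first_column \<kappa> I w d1 \<noteq> 0}"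
  have "open ?E"
    by (intro open_Collect_neq continuous_intros)
  moreover have "(\<lambda>_. 1) \<in> ?E"
    using dims batch \<kappa>_pos by (simp add: first_column_def)
  ultimately show "emeasure P ?E \<noteq> 0" "?E \<in> sets P"
    using emeasure_P_open_pos by (auto simp: sets_P)
  show "AE w in P. gain \<kappa> I d1 w powr s \<le> gain \<kappa> I d2 w powr s"
    using dims s_pos by (intro AE_I2 powr_mono2) (auto simp: gain_def intro!: L2_set_mono2)
  show "AE w in P. w \<in> ?E \<longrightarrow> gain \<kappa> I d1 w powr s \<noteq> gain \<kappa> I d2 w powr s"
    using dims s_pos by (intro AE_I2 impI less_imp_neq powr_less_mono2)
      (auto simp: gain_def intro!: L2_set_strict_mono2[of _ _ d1])
qed (use assms in \<open>auto intro!: integrable_gain_powr\<close>)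

lemma N_eq_distr_std_normal: "N = distr (density lborel (normal_density 0 1)) borel (\<lambda>x. sqrt v * x)"
proof -
  interpret S: prob_space "density lborel (normal_density 0 1)"
    by (rule prob_space_normal_density) simp
  have "distributed (density lborel (normal_density 0 1)) lborel (\<lambda>x. x) (normal_density 0 1)"
    by (simp add: distributed_def distr_id2)
  then have "distributed (density lborel (normal_density 0 1)) lborel (\<lambda>x. 0 + sqrt v * x)
      (normal_density (0 + sqrt v * 0) (\<bar>sqrt v\<bar> * 1))"
    using v_pos by (intro S.normal_density_affine) simp_all
  then have "N = distr (density lborel (normal_density 0 1)) lborel (\<lambda>x. sqrt v * x)"
    using v_pos by (simp add: distributed_def)
  also have "\<dots> = distr (density lborel (normal_density 0 1)) borel (\<lambda>x. sqrt v * x)"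
    by (rule distr_cong) simp_all
  finally show ?thesis .
qed

lemma power_moment_gain_scale:
  "power_moment P (gain \<kappa> I d) s = power_moment (data_space 1) (gain (\<kappa> * v) I d) s"
proof -
  interpret S: gaussian_data 1 by unfold_locales simp
  have scale_measurable: "(\<lambda>w j. sqrt v * w j) \<in> S.P \<rightarrow>\<^sub>M P"
    by (intro measurable_PiM_single') (auto simp: space_PiM)
  have "distr S.P P (\<lambda>w j. sqrt v * w j) = distr S.P (PiM UNIV (\<lambda>_. borel)) (\<lambda>w j. sqrt v * w j)"
    by (intro distr_cong) (simp_all add: sets_P sets_PiM_equal_borel)
  also have "\<dots> = P"
    using S.data.distr_PiM_map[of "\<lambda>_ x. sqrt v * x" "\<lambda>_. borel"] N_eq_distr_std_normal
    by (simp add: restrict_def)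
  finally have distr_scale: "distr S.P P (\<lambda>w j. sqrt v * w j) = P" .
  have "gain \<kappa> I d (\<lambda>j. sqrt v * w j) = gain (\<kappa> * v) I d w" for w
  proof -
    have "sqrt v * x * (sqrt v * y) = v * (x * y)" for x y
      using v_pos real_sqrt_mult_self[of v] by (simp only: mult_ac) simp
    then show ?thesis
      by (simp only: gain_def first_column_def) (simp add: sum_distrib_left mult.assoc)
  qed
  then have "power_moment (distr S.P P (\<lambda>w j. sqrt v * w j)) (gain \<kappa> I d) s
      = power_moment S.P (gain (\<kappa> * v) I d) s"
    unfolding power_moment_def by (subst integral_distr[OF scale_measurable]) simp_all
  then show ?thesis
    by (simp only: distr_scale S.data_space_eq)
qed

end

lemma (in sgd) hfun_eq_power_moment_gain:
  "s > 0 \<Longrightarrow> hfun \<eta> v b d s = power_moment P (gain (\<eta> / real b) {1..b} d) s"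
  by (simp only: hfun_eq_power_moment batch_gain_def)

lemma hfun_batch_less:
  assumes "sgd v \<eta> b1 d" "b1 < b2" "s \<ge> 1"
  shows "hfun \<eta> v b2 d s < hfun \<eta> v b1 d s"
proof -
  have Suc_less: "hfun \<eta> v (Suc b) d s < hfun \<eta> v b d s" if "b1 \<le> b" for b
  proof -
    interpret b: sgd v \<eta> b d
      using assms(1) that by (auto simp: sgd_def sgd_axioms_def)
    interpret Suc_b: sgd v \<eta> "Suc b" d
      using assms(1) by (auto simp: sgd_def sgd_axioms_def)
    show ?thesis
      using b.power_moment_gain_batch_Suc[OF b.d_pos b.b_pos b.\<eta>_pos assms(3)] assms(3)
      by (simp only: b.hfun_eq_power_moment_gain Suc_b.hfun_eq_power_moment_gain)
  qed
  show ?thesis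
    using Suc_leI[OF assms(2)]
  proof (induction rule: dec_induct)
    case base
    show ?case by (rule Suc_less) simp
  next
    case (step b)
    then show ?case using Suc_less[of b] by simp
  qed
qed

lemma hfun_stepsize_variance_less:
  assumes "sgd v1 \<eta>1 b d" "sgd v2 \<eta>2 b d" and less: "\<eta>1 * v1 < \<eta>2 * v2" and s_ge_1: "s \<ge> 1"
  defines "t \<equiv> \<eta>1 * v1 / (\<eta>2 * v2)"
  shows "hfun \<eta>1 v1 b d s < t * hfun \<eta>2 v2 b d s + (1 - t)"
proof -
  interpret s1: sgd v1 \<eta>1 b d by fact
  interpret s2: sgd v2 \<eta>2 b d by fact
  interpret S: gaussian_data 1 by unfold_locales simp
  let ?\<kappa>1 = "\<eta>1 / real b * v1" and ?\<kappa>2 = "\<eta>2 / real b * v2"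
  have b_pos: "real b > 0" using s1.b_pos by simp
  then have "0 < ?\<kappa>1" "?\<kappa>1 < ?\<kappa>2" and "?\<kappa>1 / ?\<kappa>2 = t"
    using less s1.\<eta>_pos s1.v_pos by (simp_all add: divide_strict_right_mono t_def)
  then have "power_moment S.P (gain ?\<kappa>1 {1..b} d) s
      < t * power_moment S.P (gain ?\<kappa>2 {1..b} d) s + (1 - t)"
    using S.power_moment_gain_stepsize[of d "{1..b}" ?\<kappa>1 ?\<kappa>2 s] s_ge_1 s1.d_pos s1.b_pos by simp
  then show ?thesis
    using s_ge_1 by (simp only: s1.hfun_eq_power_moment_gain s2.hfun_eq_power_moment_gain
        s1.power_moment_gain_scale s2.power_moment_gain_scale S.data_space_eq)
qed

lemma hfun_dim_less:
  assumes "sgd v \<eta> b d1" "d1 < d2" "s > 0"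
  shows "hfun \<eta> v b d1 s < hfun \<eta> v b d2 s"
proof -
  interpret s1: sgd v \<eta> b d1 by fact
  interpret s2: sgd v \<eta> b d2
    using assms(1,2) by (auto simp: sgd_def sgd_axioms_def)
  show ?thesis
    using assms(2,3) s1.d_pos s1.b_pos s1.\<eta>_pos
    by (simp only: s1.hfun_eq_power_moment_gain s2.hfun_eq_power_moment_gain)
      (intro s1.power_moment_gain_dim, auto)
qed

section \<open>Monotonicity of the tail-index\<close>

lemma tail_index_batch_less:
  assumes "admissible \<eta> v b1 d" "admissible \<eta> v b2 d" "b1 < b2" "1 \<le> tail_index \<eta> v b1 d"
  shows "tail_index \<eta> v b1 d < tail_index \<eta> v b2 d"
proof -
  have "hfun \<eta> v b2 d (tail_index \<eta> v b1 d) < hfun \<eta> v b1 d (tail_index \<eta> v b1 d)"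
    using assms by (intro hfun_batch_less admissible_imp_sgd)
  then show ?thesis
    using assms by (simp add: hfun_tail_index hfun_less_1_iff tail_index_pos)
qed

lemma tail_index_stepsize_variance_less:
  assumes "admissible \<eta>1 v1 b d" "admissible \<eta>2 v2 b d" "\<eta>1 * v1 < \<eta>2 * v2" "1 \<le> tail_index \<eta>1 v1 b d"
  shows "tail_index \<eta>2 v2 b d < tail_index \<eta>1 v1 b d"
proof -
  define \<alpha> where "\<alpha> = tail_index \<eta>1 v1 b d"
  define t where "t = \<eta>1 * v1 / (\<eta>2 * v2)"
  have "t > 0"
    using assms(1,2) by (simp add: t_def admissible_def)
  have "hfun \<eta>1 v1 b d \<alpha> < t * hfun \<eta>2 v2 b d \<alpha> + (1 - t)"
    unfolding t_def \<alpha>_def using assms by (intro hfun_stepsize_variance_less admissible_imp_sgd)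
  then have "t * 1 < t * hfun \<eta>2 v2 b d \<alpha>"
    using assms(1) by (simp add: hfun_tail_index \<alpha>_def)
  then have "1 < hfun \<eta>2 v2 b d \<alpha>"
    using \<open>t > 0\<close> by (simp only: mult_less_cancel_left_pos)
  then show ?thesis
    using assms(1,2) by (simp add: hfun_greater_1_iff tail_index_pos \<alpha>_def)
qed

lemma tail_index_dim_less:
  assumes "admissible \<eta> v b d1" "admissible \<eta> v b d2" "d1 < d2"
  shows "tail_index \<eta> v b d2 < tail_index \<eta> v b d1"
proof -
  have "hfun \<eta> v b d1 (tail_index \<eta> v b d1) < hfun \<eta> v b d2 (tail_index \<eta> v b d1)"
    using assms by (intro hfun_dim_less admissible_imp_sgd tail_index_pos)
  then show ?thesis
    using assms by (simp add: hfun_tail_index hfun_greater_1_iff tail_index_pos)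
qed

theorem theorem4:
  shows
   "(\<forall>\<eta> v d b1 b2. admissible \<eta> v b1 d \<and> admissible \<eta> v b2 d \<and> b1 < b2 \<and>
        tail_index \<eta> v b1 d \<ge> 1 \<and> tail_index \<eta> v b2 d \<ge> 1
        \<longrightarrow> tail_index \<eta> v b1 d < tail_index \<eta> v b2 d)
  \<and> (\<forall>\<eta>1 \<eta>2 v b d. admissible \<eta>1 v b d \<and> admissible \<eta>2 v b d \<and> \<eta>1 < \<eta>2 \<and>
        tail_index \<eta>1 v b d \<ge> 1 \<and> tail_index \<eta>2 v b d \<ge> 1
        \<longrightarrow> tail_index \<eta>2 v b d < tail_index \<eta>1 v b d)
  \<and> (\<forall>\<eta> v1 v2 b d. admissible \<eta> v1 b d \<and> admissible \<eta> v2 b d \<and> v1 < v2 \<and>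
        tail_index \<eta> v1 b d \<ge> 1 \<and> tail_index \<eta> v2 b d \<ge> 1
        \<longrightarrow> tail_index \<eta> v2 b d < tail_index \<eta> v1 b d)
  \<and> (\<forall>\<eta> v b d1 d2. admissible \<eta> v b d1 \<and> admissible \<eta> v b d2 \<and> d1 < d2
        \<longrightarrow> tail_index \<eta> v b d2 < tail_index \<eta> v b d1)"
proof (intro conjI allI impI; elim conjE)
  show "tail_index \<eta> v b1 d < tail_index \<eta> v b2 d"
    if "admissible \<eta> v b1 d" "admissible \<eta> v b2 d" "b1 < b2" "1 \<le> tail_index \<eta> v b1 d" for \<eta> v d b1 b2
    using that by (rule tail_index_batch_less)
  show "tail_index \<eta>2 v b d < tail_index \<eta>1 v b d"
    if "admissible \<eta>1 v b d" "admissible \<eta>2 v b d" "\<eta>1 < \<eta>2" "1 \<le> tail_index \<eta>1 v b d" for \<eta>1 \<eta>2 v b d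
    using that by (intro tail_index_stepsize_variance_less) (auto simp: admissible_def)
  show "tail_index \<eta> v2 b d < tail_index \<eta> v1 b d"
    if "admissible \<eta> v1 b d" "admissible \<eta> v2 b d" "v1 < v2" "1 \<le> tail_index \<eta> v1 b d" for \<eta> v1 v2 b d
    using that by (intro tail_index_stepsize_variance_less) (auto simp: admissible_def)
  show "tail_index \<eta> v b d2 < tail_index \<eta> v b d1"
    if "admissible \<eta> v b d1" "admissible \<eta> v b d2" "d1 < d2" for \<eta> v b d1 d2
    using that by (rule tail_index_dim_less)
qed

end
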